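(* Let $K$ be an algebraically closed field of characteristic zero, let $V_1,V_2$ be $K$-vector spaces with $\dim V_i=n_i+1$, write $\mathbb{P}^{n_i}=\mathbb{P}(V_i)$, and let $d_1,d_2$ be positive integers. Let $0\ne p\in S^{d_1}V_1\otimes S^{d_2}V_2$ have rank $r(p)$ such that either (a) $2r(p)\le 1+d_1+d_2$ and $|d_1-d_2|\le2$, or (b) $r(p)\le\min\{d_1,d_2\}$. Assume $\sharp(\mathcal{S}(p))\ge2$, and assume that it is not the case that (a) holds with $d_1\ne d_2$ and $p$ depends only on one factor. For a pair $S,A\in\mathcal{S}(p)$ with $S\neq A$ consider the following two cases: (i) there are an integer $b$ with $2\le b\le(d_2+2)/2$ and $r(p)\ge d_2+2-b$, a $\beta$-line $T=[p_1]\times L$, and a set $E\subset\mathbb{P}^{n_1}\times\mathbb{P}^{n_2}$ with $\sharp(E)=r(p)+b-d_2-2$, $E\cap T=\emptyset$, $S=E\sqcup(S\cap T)$, $A=E\sqcup(A\cap T)$; (ii) there are an integer $b$ with $2\le b\le\lfloor(d_1+2)/2\rfloor$ and $r(p)\ge d_1+2-b$, an $\alpha$-line $T=R\times[p_2]$, and a set $E\subset\mathbb{P}^{n_1}\times\mathbb{P}^{n_2}$ with $\sharp(E)=r(p)+b-d_1-2$, $E\cap T=\emptyset$, $S=E\sqcup(S\cap T)$, $A=E\sqcup(A\cap T)$. Then: 1. Whether case (i) or case (ii) holds, and the value of the integer $b$, depend only on $p$, not on the choice of $S,A\in\mathcal{S}(p)$ with $S\ne A$. 2. The $\beta$-line $T=[p_1]\times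 L$ (in case (i)) or the $\alpha$-line $T=R\times[p_2]$ (in case (ii)), and the set $E=S\setminus(S\cap T)=A\setminus(A\cap T)$, depend only on $[p]$, not on the choice of $S,A\in\mathcal{S}(p)$ with $S\neq A$.
   Context: $\nu_{d_1,d_2}:\mathbb{P}(V_1)\times\mathbb{P}(V_2)\to\mathbb{P}(S^{d_1}V_1\otimes S^{d_2}V_2)$ is the Segre-Veronese embedding given by $|\mathcal{O}(d_1,d_2)|$, i.e. $([v_1],[v_2])\mapsto[v_1^{\otimes d_1}\otimes v_2^{\otimes d_2}]$. $\langle\,\cdot\,\rangle$ denotes linear span. The rank $r(p)$ is the minimal $r$ such that $p$ is a linear combination of $r$ tensors of the form $v_1^{\otimes d_1}\otimes v_2^{\otimes d_2}$, $v_i\in V_i$. $\mathcal{S}(p)$ is the set of all finite sets $S\subset\mathbb{P}^{n_1}\times\mathbb{P}^{n_2}$ with $[p]\in\langle\nu_{d_1,d_2}(S)\rangle$ and $\sharp(S)=r(p)$. An $\alpha$-line is a curve $R\times[p_2]$ with $R\subset\mathbb{P}^{n_1}$ a line and $[p_2]\in\mathbb{P}^{n_2}$; a $\beta$-line is a curve $[p_1]\times L$ with $[p_1]\in\mathbb{P}^{n_1}$ and $L\subset\mathbb{P}^{n_2}$ a line. $\sqcup$ denotes disjoint union. "$p$ depends only on one factor" means that $[p]\in\langle\nu_{d_1,d_2}(\mathbb{P}^{n_1}\times[p_2])\rangle$ for some $[p_2]\in\mathbb{P}^{n_2}$ or $[p]\in\langle\nu_{d_1,d_2}([p_1]\times\mathbb{P}^{n_2})\rangle$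 for some $[p_1]\in\mathbb{P}^{n_1}$. Under the stated hypotheses, the paper's decomposition theorem says that each pair $S\ne A$ in $\mathcal{S}(p)$ falls in case (i) or case (ii). *)

theory Defs
  imports Complex_Main "HOL-Computational_Algebra.Polynomial"
    "HOL-Library.Function_Algebras" "HOL-Library.Multiset"
begin

section \<open>Projective spaces\<close>

text \<open>
  A vector space is given by its scalar multiplication \<open>s :: 'k \<Rightarrow> 'v \<Rightarrow> 'v\<close> on the whole
  type \<open>'v\<close>. A point of the associated projective space is a one-dimensional linear subspace.
\<close>

definition proj_pt :: "('k::field \<Rightarrow> 'v::ab_group_add \<Rightarrow> 'v) \<Rightarrow> 'v \<Rightarrow> 'v set" where
  "proj_pt s v = module.span s {v}"

definition proj_space :: "('k::field \<Rightarrow> 'v::ab_group_add \<Rightarrow> 'v) \<Rightarrow> 'v set set" where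
  "proj_space s = {proj_pt s v | v. v \<noteq> 0}"

definition proj_line :: "('k::field \<Rightarrow> 'v::ab_group_add \<Rightarrow> 'v) \<Rightarrow> 'v set set \<Rightarrow> bool" where
  "proj_line s R \<longleftrightarrow>
    (\<exists>U. module.subspace s U \<and> vector_space.dim s U = 2 \<and> R = {P \<in> proj_space s. P \<subseteq> U})"

definition proj_span :: "('k::field \<Rightarrow> 'v::ab_group_add \<Rightarrow> 'v) \<Rightarrow> 'v set set \<Rightarrow> 'v set set" where
  "proj_span s X = {P \<in> proj_space s. P \<subseteq> module.span s (\<Union>X)}"


section \<open>The tensor space\<close>

text \<open>
  For a finite-dimensional space \<open>V\<close> over a field of characteristic zero, \<open>S\<^sup>d V\<close> is the space of
  symmetric elements of the \<open>d\<close>-th tensor power of \<open>V\<close>, i.e. of symmetric \<open>d\<close>-linear forms on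
  the dual space. Accordingly \<open>S\<^sup>d\<^sup>1 V\<^sub>1 \<otimes> S\<^sup>d\<^sup>2 V\<^sub>2\<close> consists of the multilinear forms in \<open>d1\<close> linear
  functionals on \<open>V\<^sub>1\<close> and \<open>d2\<close> linear functionals on \<open>V\<^sub>2\<close> that are symmetric in each of the two
  groups of arguments. The arguments are passed as lists, and a form is set to 0 on
  lists that are not admissible, so that equality of tensors is equality of functions.
\<close>

type_synonym ('v, 'w, 'k) tensor = "('v \<Rightarrow> 'k) list \<Rightarrow> ('w \<Rightarrow> 'k) list \<Rightarrow> 'k"

definition dual :: "('k::field \<Rightarrow> 'v::ab_group_add \<Rightarrow> 'v) \<Rightarrow> ('v \<Rightarrow> 'k) set" where
  "dual s = {f. Vector_Spaces.linear s (*) f}"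

definition dual_lists ::
    "('k::field \<Rightarrow> 'v::ab_group_add \<Rightarrow> 'v) \<Rightarrow> nat \<Rightarrow> ('v \<Rightarrow> 'k) list set" where
  "dual_lists s d = {fs. length fs = d \<and> set fs \<subseteq> dual s}"

definition sym_multilinear ::
    "('k::field \<Rightarrow> 'v::ab_group_add \<Rightarrow> 'v) \<Rightarrow> nat \<Rightarrow> (('v \<Rightarrow> 'k) list \<Rightarrow> 'k) \<Rightarrow> bool" where
  "sym_multilinear s d F \<longleftrightarrow>
    (\<forall>fs. fs \<notin> dual_lists s d \<longrightarrow> F fs = 0) \<and>
    (\<forall>fs \<in> dual_lists s d. \<forall>fs'. mset fs' = mset fs \<longrightarrow> F fs' = F fs) \<and>
    (\<forall>fs \<in> dual_lists s d. \<forall>i<d. \<forall>f \<in> dual s. \<forall>g \<in> dual s.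
        F (fs[i := (\<lambda>x. f x + g x)]) = F (fs[i := f]) + F (fs[i := g])) \<and>
    (\<forall>fs \<in> dual_lists s d. \<forall>i<d. \<forall>f \<in> dual s. \<forall>c.
        F (fs[i := (\<lambda>x. c * f x)]) = c * F (fs[i := f]))"

definition sym_tensor_space ::
    "('k::field \<Rightarrow> 'v::ab_group_add \<Rightarrow> 'v) \<Rightarrow> ('k \<Rightarrow> 'w::ab_group_add \<Rightarrow> 'w) \<Rightarrow> nat \<Rightarrow> nat \<Rightarrow>
      ('v, 'w, 'k) tensor set" where
  "sym_tensor_space s1 s2 d1 d2 =
    {t. (\<forall>gs. sym_multilinear s1 d1 (\<lambda>fs. t fs gs)) \<and> (\<forall>fs. sym_multilinear s2 d2 (t fs))}"

definition tensor_scale :: "'k::field \<Rightarrow> ('v, 'w, 'k) tensor \<Rightarrow> ('v, 'w, 'k) tensor" where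
  "tensor_scale c t = (\<lambda>fs gs. c * t fs gs)"

definition tensor_power ::
    "('k::field \<Rightarrow> 'v::ab_group_add \<Rightarrow> 'v) \<Rightarrow> nat \<Rightarrow> 'v \<Rightarrow> ('v \<Rightarrow> 'k) list \<Rightarrow> 'k" where
  "tensor_power s d v fs = (if fs \<in> dual_lists s d then (\<Prod>f\<leftarrow>fs. f v) else 0)"

text \<open>The tensor \<open>v\<^sup>\<otimes>\<^sup>d\<^sup>1 \<otimes> w\<^sup>\<otimes>\<^sup>d\<^sup>2\<close>:\<close>

definition rank_one_tensor ::
    "('k::field \<Rightarrow> 'v::ab_group_add \<Rightarrow> 'v) \<Rightarrow> ('k \<Rightarrow> 'w::ab_group_add \<Rightarrow> 'w) \<Rightarrow> nat \<Rightarrow> nat \<Rightarrow>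
      'v \<Rightarrow> 'w \<Rightarrow> ('v, 'w, 'k) tensor" where
  "rank_one_tensor s1 s2 d1 d2 v w = (\<lambda>fs gs. tensor_power s1 d1 v fs * tensor_power s2 d2 w gs)"

definition tensor_rank ::
    "('k::field \<Rightarrow> 'v::ab_group_add \<Rightarrow> 'v) \<Rightarrow> ('k \<Rightarrow> 'w::ab_group_add \<Rightarrow> 'w) \<Rightarrow> nat \<Rightarrow> nat \<Rightarrow>
      ('v, 'w, 'k) tensor \<Rightarrow> nat" where
  "tensor_rank s1 s2 d1 d2 p =
    (LEAST r. \<exists>c v w. p = (\<Sum>i<r. tensor_scale (c i) (rank_one_tensor s1 s2 d1 d2 (v i) (w i))))"


section \<open>The Segre-Veronese embedding and minimal decompositions\<close>

text \<open>
  The image of \<open>([v], [w])\<close> is written without choosing representatives; the lemma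
  \<open>segre_veronese_proj_pt\<close> below shows that it is \<open>[v\<^sup>\<otimes>\<^sup>d\<^sup>1 \<otimes> w\<^sup>\<otimes>\<^sup>d\<^sup>2]\<close>.
\<close>

definition segre_veronese ::
    "('k::field \<Rightarrow> 'v::ab_group_add \<Rightarrow> 'v) \<Rightarrow> ('k \<Rightarrow> 'w::ab_group_add \<Rightarrow> 'w) \<Rightarrow> nat \<Rightarrow> nat \<Rightarrow>
      'v set \<times> 'w set \<Rightarrow> ('v, 'w, 'k) tensor set" where
  "segre_veronese s1 s2 d1 d2 =
    (\<lambda>(P, Q). module.span tensor_scale {rank_one_tensor s1 s2 d1 d2 v w | v w. v \<in> P \<and> w \<in> Q})"

definition min_decomps ::
    "('k::field \<Rightarrow> 'v::ab_group_add \<Rightarrow> 'v) \<Rightarrow> ('k \<Rightarrow> 'w::ab_group_add \<Rightarrow> 'w) \<Rightarrow> nat \<Rightarrow> nat \<Rightarrow>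
      ('v, 'w, 'k) tensor \<Rightarrow> ('v set \<times> 'w set) set set" where
  "min_decomps s1 s2 d1 d2 p =
    {S. finite S \<and> S \<subseteq> proj_space s1 \<times> proj_space s2 \<and>
        proj_pt tensor_scale p \<in> proj_span tensor_scale (segre_veronese s1 s2 d1 d2 ` S) \<and>
        card S = tensor_rank s1 s2 d1 d2 p}"

definition depends_on_one_factor ::
    "('k::field \<Rightarrow> 'v::ab_group_add \<Rightarrow> 'v) \<Rightarrow> ('k \<Rightarrow> 'w::ab_group_add \<Rightarrow> 'w) \<Rightarrow> nat \<Rightarrow> nat \<Rightarrow>
      ('v, 'w, 'k) tensor \<Rightarrow> bool" where
  "depends_on_one_factor s1 s2 d1 d2 p \<longleftrightarrow>
    (\<exists>Q \<in> proj_space s2. proj_pt tensor_scale p \<in>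
        proj_span tensor_scale (segre_veronese s1 s2 d1 d2 ` (proj_space s1 \<times> {Q}))) \<or>
    (\<exists>P \<in> proj_space s1. proj_pt tensor_scale p \<in>
        proj_span tensor_scale (segre_veronese s1 s2 d1 d2 ` ({P} \<times> proj_space s2)))"

definition alpha_line ::
    "('k::field \<Rightarrow> 'v::ab_group_add \<Rightarrow> 'v) \<Rightarrow> ('k \<Rightarrow> 'w::ab_group_add \<Rightarrow> 'w) \<Rightarrow>
      ('v set \<times> 'w set) set \<Rightarrow> bool" where
  "alpha_line s1 s2 T \<longleftrightarrow> (\<exists>R Q. proj_line s1 R \<and> Q \<in> proj_space s2 \<and> T = R \<times> {Q})"

definition beta_line ::
    "('k::field \<Rightarrow> 'v::ab_group_add \<Rightarrow> 'v) \<Rightarrow> ('k \<Rightarrow> 'w::ab_group_add \<Rightarrow> 'w) \<Rightarrow>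
      ('v set \<times> 'w set) set \<Rightarrow> bool" where
  "beta_line s1 s2 T \<longleftrightarrow> (\<exists>P L. P \<in> proj_space s1 \<and> proj_line s2 L \<and> T = {P} \<times> L)"

text \<open>Cases (i) and (ii) for the pair \<open>S\<close>, \<open>A\<close>, with the data \<open>b\<close>, \<open>T\<close>, \<open>E\<close> made explicit.\<close>

definition case_i ::
    "('k::field \<Rightarrow> 'v::ab_group_add \<Rightarrow> 'v) \<Rightarrow> ('k \<Rightarrow> 'w::ab_group_add \<Rightarrow> 'w) \<Rightarrow> nat \<Rightarrow> nat \<Rightarrow>
      ('v, 'w, 'k) tensor \<Rightarrow> ('v set \<times> 'w set) set \<Rightarrow> ('v set \<times> 'w set) set \<Rightarrow>
      int \<Rightarrow> ('v set \<times> 'w set) set \<Rightarrow> ('v set \<times> 'w set) set \<Rightarrow> bool" where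
  "case_i s1 s2 d1 d2 p S A b T E \<longleftrightarrow>
    2 \<le> b \<and> 2 * b \<le> int d2 + 2 \<and>
    int (tensor_rank s1 s2 d1 d2 p) \<ge> int d2 + 2 - b \<and>
    beta_line s1 s2 T \<and>
    E \<subseteq> proj_space s1 \<times> proj_space s2 \<and> finite E \<and>
    int (card E) = int (tensor_rank s1 s2 d1 d2 p) + b - int d2 - 2 \<and>
    E \<inter> T = {} \<and> S = E \<union> (S \<inter> T) \<and> A = E \<union> (A \<inter> T)"

definition case_ii ::
    "('k::field \<Rightarrow> 'v::ab_group_add \<Rightarrow> 'v) \<Rightarrow> ('k \<Rightarrow> 'w::ab_group_add \<Rightarrow> 'w) \<Rightarrow> nat \<Rightarrow> nat \<Rightarrow>
      ('v, 'w, 'k) tensor \<Rightarrow> ('v set \<times> 'w set) set \<Rightarrow> ('v set \<times> 'w set) set \<Rightarrow>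
      int \<Rightarrow> ('v set \<times> 'w set) set \<Rightarrow> ('v set \<times> 'w set) set \<Rightarrow> bool" where
  "case_ii s1 s2 d1 d2 p S A b T E \<longleftrightarrow>
    2 \<le> b \<and> b \<le> (int d1 + 2) div 2 \<and>
    int (tensor_rank s1 s2 d1 d2 p) \<ge> int d1 + 2 - b \<and>
    alpha_line s1 s2 T \<and>
    E \<subseteq> proj_space s1 \<times> proj_space s2 \<and> finite E \<and>
    int (card E) = int (tensor_rank s1 s2 d1 d2 p) + b - int d1 - 2 \<and>
    E \<inter> T = {} \<and> S = E \<union> (S \<inter> T) \<and> A = E \<union> (A \<inter> T)"


section \<open>Basic facts\<close>

lemma vector_space_tensor_scale: "vector_space tensor_scale"
  by unfold_locales (auto simp: tensor_scale_def fun_eq_iff algebra_simps)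

lemma dual_iff:
  fixes f :: "'v::ab_group_add \<Rightarrow> 'k::field"
  shows "f \<in> dual s \<longleftrightarrow>
    vector_space s \<and> (\<forall>x y. f (x + y) = f x + f y) \<and> (\<forall>c x. f (s c x) = c * f x)"
proof -
  have "vector_space ((*) :: 'k \<Rightarrow> 'k \<Rightarrow> 'k)"
    by unfold_locales (simp_all add: distrib_left distrib_right)
  then show ?thesis
    by (auto simp: dual_def Vector_Spaces.linear_def module_hom_iff module_iff_vector_space)
qed

lemma dual_add: "f \<in> dual s \<Longrightarrow> g \<in> dual s \<Longrightarrow> (\<lambda>x. f x + g x) \<in> dual s"
  by (simp add: dual_iff algebra_simps)

lemma dual_scale: "f \<in> dual s \<Longrightarrow> (\<lambda>x. c * f x) \<in> dual s"
  by (simp add: dual_iff algebra_simps)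

lemma dual_lists_update:
  assumes "fs \<in> dual_lists s d" "f \<in> dual s"
  shows "fs[i := f] \<in> dual_lists s d"
  using assms set_update_subset_insert[of fs i f] by (auto simp: dual_lists_def)

lemma prod_list_update:
  fixes fs :: "('v \<Rightarrow> 'k::comm_monoid_mult) list"
  assumes "i < length fs"
  shows "(\<Prod>h\<leftarrow>fs[i := f]. h v) = f v * ((\<Prod>h\<leftarrow>take i fs. h v) * (\<Prod>h\<leftarrow>drop (Suc i) fs. h v))"
  using assms by (simp add: upd_conv_take_nth_drop mult_ac)

lemma sym_multilinear_tensor_power: "sym_multilinear s d (tensor_power s d v)"
  unfolding sym_multilinear_def
proof (intro conjI allI ballI impI)
  fix fs fs' :: "('b \<Rightarrow> 'a) list"
  assume fs: "fs \<in> dual_lists s d" and eq: "mset fs' = mset fs"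
  have "fs' \<in> dual_lists s d"
    using fs mset_eq_length[OF eq] mset_eq_setD[OF eq] by (simp add: dual_lists_def)
  moreover have "(\<Prod>f\<leftarrow>fs'. f v) = (\<Prod>f\<leftarrow>fs. f v)"
    using eq by (metis mset_map prod_mset_prod_list)
  ultimately show "tensor_power s d v fs' = tensor_power s d v fs"
    using fs by (simp add: tensor_power_def)
next
  fix fs :: "('b \<Rightarrow> 'a) list" and i f g
  assume fs: "fs \<in> dual_lists s d" and i: "i < d" and f: "f \<in> dual s" and g: "g \<in> dual s"
  have "i < length fs" using fs i by (simp add: dual_lists_def)
  then show "tensor_power s d v (fs[i := \<lambda>x. f x + g x]) =
      tensor_power s d v (fs[i := f]) + tensor_power s d v (fs[i := g])"
    using dual_lists_update[OF fs f] dual_lists_update[OF fs g]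
      dual_lists_update[OF fs dual_add[OF f g]]
    by (simp add: tensor_power_def prod_list_update algebra_simps)
next
  fix fs :: "('b \<Rightarrow> 'a) list" and i f c
  assume fs: "fs \<in> dual_lists s d" and i: "i < d" and f: "f \<in> dual s"
  have "i < length fs" using fs i by (simp add: dual_lists_def)
  then show "tensor_power s d v (fs[i := \<lambda>x. c * f x]) = c * tensor_power s d v (fs[i := f])"
    using dual_lists_update[OF fs f] dual_lists_update[OF fs dual_scale[OF f]]
    by (simp add: tensor_power_def prod_list_update algebra_simps)
qed (simp add: tensor_power_def)

lemma sym_multilinear_times:
  assumes F: "sym_multilinear s d F"
  shows "sym_multilinear s d (\<lambda>fs. c * F fs)" "sym_multilinear s d (\<lambda>fs. F fs * c)"
proof -
  show *: "sym_multilinear s d (\<lambda>fs. c * F fs)"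
    unfolding sym_multilinear_def
  proof (intro conjI allI ballI impI)
    fix fs fs'
    assume "fs \<in> dual_lists s d" "mset fs' = mset fs"
    then have "F fs' = F fs" using F unfolding sym_multilinear_def by blast
    then show "c * F fs' = c * F fs" by (rule arg_cong)
  next
    fix fs i f g
    assume "fs \<in> dual_lists s d" "i < d" "f \<in> dual s" "g \<in> dual s"
    then have "F (fs[i := \<lambda>x. f x + g x]) = F (fs[i := f]) + F (fs[i := g])"
      using F unfolding sym_multilinear_def by blast
    then show "c * F (fs[i := \<lambda>x. f x + g x]) = c * F (fs[i := f]) + c * F (fs[i := g])"
      by (simp only: distrib_left)
  next
    fix fs i f a
    assume "fs \<in> dual_lists s d" "i < d" "f \<in> dual s"
    then have "F (fs[i := \<lambda>x. a * f x]) = a * F (fs[i := f])"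
      using F unfolding sym_multilinear_def by blast
    then show "c * F (fs[i := \<lambda>x. a * f x]) = a * (c * F (fs[i := f]))"
      by (simp only: mult.left_commute)
  next
    fix fs
    assume "fs \<notin> dual_lists s d"
    then have "F fs = 0" using F unfolding sym_multilinear_def by blast
    then show "c * F fs = 0" by simp
  qed
  then show "sym_multilinear s d (\<lambda>fs. F fs * c)"
    by (simp only: mult.commute[of _ c])
qed

lemma rank_one_tensor_in_sym_tensor_space:
  "rank_one_tensor s1 s2 d1 d2 v w \<in> sym_tensor_space s1 s2 d1 d2"
  unfolding sym_tensor_space_def rank_one_tensor_def
  by (auto intro!: sym_multilinear_times sym_multilinear_tensor_power)

lemma tensor_power_scale: "tensor_power s d (s c v) fs = c ^ d * tensor_power s d v fs"
proof -
  have "(\<Prod>f\<leftarrow>fs. f (s c v)) = c ^ length fs * (\<Prod>f\<leftarrow>fs. f v)" if "set fs \<subseteq> dual s" for fs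
    using that by (induction fs) (auto simp: dual_iff algebra_simps)
  then show ?thesis by (auto simp: tensor_power_def dual_lists_def)
qed

lemma segre_veronese_proj_pt:
  assumes "vector_space s1" "vector_space s2"
  shows "segre_veronese s1 s2 d1 d2 (proj_pt s1 v, proj_pt s2 w) =
    proj_pt tensor_scale (rank_one_tensor s1 s2 d1 d2 v w)"
proof -
  interpret V: vector_space s1 by fact
  interpret W: vector_space s2 by fact
  interpret T: vector_space tensor_scale by (rule vector_space_tensor_scale)
  let ?t = "rank_one_tensor s1 s2 d1 d2"
  have sc: "?t (s1 a v) (s2 b w) = tensor_scale (a ^ d1 * b ^ d2) (?t v w)" for a b
    by (simp add: rank_one_tensor_def tensor_scale_def tensor_power_scale mult_ac)
  have "{?t v' w' | v' w'. v' \<in> V.span {v} \<and> w' \<in> W.span {w}} \<subseteq> T.span {?t v w}"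
    by (auto simp: V.span_singleton W.span_singleton T.span_singleton sc)
  moreover have "{?t v w} \<subseteq> {?t v' w' | v' w'. v' \<in> V.span {v} \<and> w' \<in> W.span {w}}"
    using V.span_base[of v "{v}"] W.span_base[of w "{w}"] by blast
  ultimately have "T.span {?t v' w' | v' w'. v' \<in> V.span {v} \<and> w' \<in> W.span {w}} = T.span {?t v w}"
    by (intro iffD2[OF T.span_eq] conjI) (assumption, erule subset_trans, rule T.span_superset)
  then show ?thesis by (simp only: segre_veronese_def proj_pt_def prod.case)
qed

end

theory Submission
  imports Defs
begin

text \<open>
  Subtracting two minimal decompositions \<open>S \<noteq> A\<close> of \<open>p\<close> gives a linear relation with nonzero
  coefficients among the points \<open>\<nu>(z)\<close>, \<open>z \<in> W\<close>, where \<open>W\<close> contains the symmetric difference of \<open>S\<close>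
  and \<open>A\<close>. Hence no form of bidegree \<open>(d1, d2)\<close> vanishes on all of \<open>W\<close> except one point. Testing this
  against products of linear forms, each killing one point, puts \<open>W\<close> into one fibre of a projection,
  and testing against hyperplanes containing several points puts it on a line \<open>T\<close> in that fibre, so
  that \<open>S - T = A - T\<close> and \<open>2 * card (S \<inter> T) \<ge> d + 2\<close>. As a binary form of degree \<open>d\<close> has rank at
  most \<open>d\<close>, also \<open>card (S \<inter> T) \<le> d\<close>. Two different lines containing that many points of \<open>S\<close> would
  contradict the bound on \<open>card S\<close>, hence \<open>T\<close> depends on \<open>S\<close> only. Passing from \<open>(S, A)\<close> to
  \<open>(S, S')\<close> and then to \<open>(S', A')\<close> shows that it is the same for all pairs.
\<close>

section \<open>Rank of binary forms\<close>

lemma finite_if_subsingleton: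
  assumes "\<And>a a'. a \<in> B \<Longrightarrow> a' \<in> B \<Longrightarrow> a = a'"
  shows "finite B"
proof (cases "B = {}")
  case False
  then obtain a where "a \<in> B" by blast
  then have "B \<subseteq> {a}" using assms by blast
  then show ?thesis by (rule finite_subset) simp
qed simp

text \<open>
  \<open>F\<close> is there for the induction: \<open>\<phi>\<close> is restricted to the multiples of \<open>X - a\<close> for a generic \<open>a\<close>,
  and the evaluation points found for the restriction have to be different from \<open>a\<close>. The exceptional
  functional \<open>coeff f d\<close> is the evaluation at infinity.
\<close>

lemma apolar_finite_evaluations:
  fixes \<phi> :: "'k::field_char_0 poly \<Rightarrow> 'k"
  assumes "d \<ge> 1"
    and "\<And>f g. \<phi> (f + g) = \<phi> f + \<phi> g" "\<And>c f. \<phi> (smult c f) = c * \<phi> f"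
    and "finite F"
    and "\<nexists>l. \<forall>f. degree f \<le> d \<longrightarrow> \<phi> f = l * coeff f d"
    and "\<And>y. y \<in> F \<Longrightarrow> \<nexists>l. \<forall>f. degree f \<le> d \<longrightarrow> \<phi> f = l * poly f y"
  shows "\<exists>Y e. finite Y \<and> card Y \<le> d \<and> Y \<inter> F = {} \<and>
    (\<forall>f. degree f \<le> d \<longrightarrow> \<phi> f = (\<Sum>y\<in>Y. e y * poly f y))"
  using assms
proof (induction d arbitrary: \<phi> F rule: nat_induct_at_least)
  case base
  have dec: "f = smult (coeff f 0) 1 + smult (coeff f 1) [:0, 1:]" if "degree f \<le> 1" for f :: "'k poly"
    using that by (auto simp: poly_eq_iff coeff_pCons coeff_eq_0 split: nat.split)
  have eq: "\<phi> f = coeff f 0 * \<phi> 1 + coeff f 1 * \<phi> [:0, 1:]" if "degree f \<le> 1" for f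
    using dec[OF that] by (metis base(1,2))
  have nz: "\<phi> 1 \<noteq> 0"
  proof
    assume "\<phi> 1 = 0"
    then have "\<forall>f. degree f \<le> 1 \<longrightarrow> \<phi> f = \<phi> [:0, 1:] * coeff f 1"
      by (metis eq add_0 mult.commute mult_zero_right)
    then show False using base(4) by blast
  qed
  have pf: "poly f y = coeff f 0 + y * coeff f 1" if "degree f \<le> 1" for f :: "'k poly" and y
    by (subst dec[OF that]) simp
  \<comment> \<open>In degree 1 a functional is fixed by its values at \<open>1\<close> and
    \<open>X\<close>. As \<open>\<phi>\<close> is not evaluation at infinity,
    \<open>\<phi> 1\<close> is nonzero, and \<open>\<phi>\<close> is \<open>\<phi> 1\<close> times
    evaluation at this quotient.\<close>
  let ?y = "\<phi> [:0, 1:] / \<phi> 1"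
  have ev: "\<phi> f = \<phi> 1 * poly f ?y" if "degree f \<le> 1" for f
    using that nz by (simp add: eq[OF that] pf[OF that] field_simps)
  then obtain y l where yl: "\<forall>f. degree f \<le> 1 \<longrightarrow> \<phi> f = l * poly f y" by blast
  then have "y \<notin> F" using base(5) by blast
  then show ?case
    using yl by (intro exI[of _ "{y}"] exI[of _ "\<lambda>_. l"]) simp
next
  case (Suc n)
  note add = Suc.prems(1) and scl = Suc.prems(2)
  have diff: "\<phi> (f - g) = \<phi> f - \<phi> g" for f g
    using add[of "f - g" g] by simp
  have zero: "\<phi> 0 = 0" using scl[of 0 0] by simp
  \<comment> \<open>A multiple of one evaluation is already a decomposition with one term. Excluding
    it is what makes the sets \<open>B1\<close> and \<open>B2 y\<close> below finite.\<close>
  show ?case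
  proof (cases "\<exists>y l. \<forall>f. degree f \<le> Suc n \<longrightarrow> \<phi> f = l * poly f y")
    case True
    then obtain y l where yl: "\<forall>f. degree f \<le> Suc n \<longrightarrow> \<phi> f = l * poly f y" by blast
    then have "y \<notin> F" using Suc.prems(5) by blast
    then show ?thesis
      using yl by (intro exI[of _ "{y}"] exI[of _ "\<lambda>_. l"]) auto
  next
    case False
    have split: "f = [:coeff f 0:] + [:0, 1:] * synthetic_div f 0" for f :: "'k poly"
      using synthetic_div_correct'[of 0 f] by (simp add: poly_0_coeff_0)
    have sp: "\<phi> f = coeff f 0 * \<phi> 1 + \<phi> ([:0, 1:] * synthetic_div f 0)" for f
    proof -
      have "f = smult (coeff f 0) 1 + [:0, 1:] * synthetic_div f 0"
        using split[of f] by simp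
      then show ?thesis by (metis add scl)
    qed
    \<comment> \<open>The ways in which the induction hypothesis can fail for the restriction of
      \<open>\<phi>\<close> to multiples of \<open>X - a\<close>: it is a multiple of evaluation at
      infinity, at \<open>a\<close> itself, or at a point \<open>y\<close> of
      \<open>F\<close>.\<close>
    define B0 where "B0 = {a. \<exists>l. \<forall>f. degree f \<le> n \<longrightarrow> \<phi> ([:- a, 1:] * f) = l * coeff f n}"
    define B1 where "B1 = {a. \<exists>l. \<forall>f. degree f \<le> n \<longrightarrow> \<phi> ([:- a, 1:] * f) = l * poly f a}"
    define B2 where "B2 y = {a. \<exists>l. \<forall>f. degree f \<le> n \<longrightarrow> \<phi> ([:- a, 1:] * f) = l * poly f y}" for y
    have lin: "\<phi> ([:- a, 1:] * f) = \<phi> ([:0, 1:] * f) - a * \<phi> f" for a f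
      by (simp flip: scl diff)
    have "finite B0"
    proof -
      \<comment> \<open>For two different values of \<open>a\<close>, both \<open>\<phi> f\<close>
        and \<open>\<phi> (X * f)\<close> vanish in degree at most \<open>n - 1\<close>, so
        \<open>\<phi>\<close> vanishes in degree at most \<open>n\<close>. Only the top coefficient
        survives, and \<open>\<phi>\<close> would be evaluation at infinity.\<close>
      have "a = a'" if aB: "a \<in> B0" "a' \<in> B0" for a a'
      proof (rule ccontr)
        assume ne: "a \<noteq> a'"
        have v: "\<phi> f = 0 \<and> \<phi> ([:0, 1:] * f) = 0" if "degree f \<le> n - 1" for f
        proof -
          have "coeff f n = 0" "degree f \<le> n" using that Suc.hyps by (auto simp: coeff_eq_0)
          then have "\<phi> ([:- a, 1:] * f) = 0" "\<phi> ([:- a', 1:] * f) = 0"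
            using aB unfolding B0_def by auto
          then have "\<phi> ([:0, 1:] * f) - a * \<phi> f = 0" "\<phi> ([:0, 1:] * f) - a' * \<phi> f = 0"
            by (simp_all only: lin)
          then show ?thesis using ne by (metis eq_iff_diff_eq_0 mult_cancel_right mult_zero_right)
        qed
        have van: "\<phi> f = 0" if "degree f \<le> n" for f
          using that v[of 1] v[of "synthetic_div f 0"]
          by (subst sp) (auto simp: degree_synthetic_div)
        have "\<phi> f = \<phi> (monom 1 (Suc n)) * coeff f (Suc n)" if "degree f \<le> Suc n" for f
        proof -
          have "degree (f - smult (coeff f (Suc n)) (monom 1 (Suc n))) \<le> n"
          proof (rule degree_le, intro allI impI)
            fix i assume "n < i"
            then show "coeff (f - smult (coeff f (Suc n)) (monom 1 (Suc n))) i = 0"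
              using that by (cases "i = Suc n") (auto simp: coeff_eq_0)
          qed
          from van[OF this] show ?thesis by (simp add: diff scl)
        qed
        then show False using Suc.prems(4) by blast
      qed
      then show ?thesis by (rule finite_if_subsingleton)
    qed
    moreover have "finite (B2 y)" for y
    proof -
      \<comment> \<open>The same argument on multiples of \<open>X - y\<close>: two values of
        \<open>a\<close> make \<open>\<phi>\<close> vanish on all of them up to degree
        \<open>Suc n\<close>, so that \<open>\<phi>\<close> is a multiple of evaluation at
        \<open>y\<close>.\<close>
      have "a = a'" if aB: "a \<in> B2 y" "a' \<in> B2 y" for a a'
      proof (rule ccontr)
        assume ne: "a \<noteq> a'"
        have v: "\<phi> ([:- y, 1:] * g) = 0 \<and> \<phi> ([:0, 1:] * ([:- y, 1:] * g)) = 0" if "degree g \<le> n - 1" for g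
        proof -
          have "degree ([:- y, 1:] * g) \<le> n" using that Suc.hyps degree_mult_le[of "[:- y, 1:]" g] by simp
          then have "\<phi> ([:- a, 1:] * ([:- y, 1:] * g)) = 0" "\<phi> ([:- a', 1:] * ([:- y, 1:] * g)) = 0"
            using aB unfolding B2_def by (auto simp del: mult_pCons_left)
          then have "\<phi> ([:0, 1:] * ([:- y, 1:] * g)) - a * \<phi> ([:- y, 1:] * g) = 0"
            "\<phi> ([:0, 1:] * ([:- y, 1:] * g)) - a' * \<phi> ([:- y, 1:] * g) = 0"
            by (simp_all only: lin)
          then show ?thesis using ne by (metis eq_iff_diff_eq_0 mult_cancel_right mult_zero_right)
        qed
        have van: "\<phi> ([:- y, 1:] * f) = 0" if "degree f \<le> n" for f
        proof -
          have "[:- y, 1:] * f = smult (coeff f 0) ([:- y, 1:] * 1)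
              + [:0, 1:] * ([:- y, 1:] * synthetic_div f 0)"
            by (subst split) (simp add: algebra_simps)
          then have "\<phi> ([:- y, 1:] * f) = coeff f 0 * \<phi> ([:- y, 1:] * 1)
              + \<phi> ([:0, 1:] * ([:- y, 1:] * synthetic_div f 0))"
            by (metis add scl)
          then show ?thesis
            using that v[of 1] v[of "synthetic_div f 0"] by (simp add: degree_synthetic_div)
        qed
        have "\<phi> f = \<phi> 1 * poly f y" if "degree f \<le> Suc n" for f
        proof -
          have "f = [:- y, 1:] * synthetic_div f y + smult (poly f y) 1"
            using synthetic_div_correct'[of y f] by simp
          then have "\<phi> f = \<phi> ([:- y, 1:] * synthetic_div f y) + poly f y * \<phi> 1"
            by (metis add scl)
          then show ?thesis using that van[of "synthetic_div f y"] by (simp add: degree_synthetic_div)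
        qed
        then show False using False by blast
      qed
      then show ?thesis by (rule finite_if_subsingleton)
    qed
    moreover have "finite B1"
    proof -
      \<comment> \<open>For \<open>a \<in> B1\<close> the polynomial \<open>(X - a) * g\<close> has
        the root \<open>a\<close>, so \<open>\<phi>\<close> kills \<open>(X - a)^2 * g\<close>. This
        is an equation of degree at most 2 in \<open>a\<close>; as \<open>\<phi>\<close> is nonzero
        in degree at most \<open>Suc n\<close>, some \<open>g\<close> makes it nontrivial, and it
        has finitely many roots.\<close>
      have "\<exists>g. degree g \<le> n - 1 \<and> (\<phi> g \<noteq> 0 \<or> \<phi> ([:0, 1:] * g) \<noteq> 0 \<or> \<phi> ([:0, 1:] * ([:0, 1:] * g)) \<noteq> 0)"
      proof (rule ccontr)
        assume "\<not> ?thesis"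
        then have v: "\<phi> g = 0 \<and> \<phi> ([:0, 1:] * g) = 0 \<and> \<phi> ([:0, 1:] * ([:0, 1:] * g)) = 0"
          if "degree g \<le> n - 1" for g using that by blast
        have "\<phi> f = 0" if "degree f \<le> Suc n" for f
        proof -
          let ?g = "synthetic_div f 0"
          have "[:0, 1:] * ?g = smult (coeff ?g 0) ([:0, 1:] * 1) + [:0, 1:] * ([:0, 1:] * synthetic_div ?g 0)"
            by (subst split) (simp add: algebra_simps)
          then have "\<phi> ([:0, 1:] * ?g) = coeff ?g 0 * \<phi> ([:0, 1:] * 1) + \<phi> ([:0, 1:] * ([:0, 1:] * synthetic_div ?g 0))"
            by (metis add scl)
          moreover have "degree (synthetic_div ?g 0) \<le> n - 1" using that by (simp add: degree_synthetic_div)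
          ultimately show ?thesis using v[of 1] v[of "synthetic_div ?g 0"] by (subst sp) simp
        qed
        then show False using False by (metis mult_zero_left)
      qed
      then obtain g where g: "degree g \<le> n - 1"
        "\<phi> g \<noteq> 0 \<or> \<phi> ([:0, 1:] * g) \<noteq> 0 \<or> \<phi> ([:0, 1:] * ([:0, 1:] * g)) \<noteq> 0" by blast
      let ?q = "[:\<phi> ([:0, 1:] * ([:0, 1:] * g)), - 2 * \<phi> ([:0, 1:] * g), \<phi> g:]"
      have "?q \<noteq> 0" using g(2) by auto
      moreover have "B1 \<subseteq> {a. poly ?q a = 0}"
      proof
        fix a assume "a \<in> B1"
        moreover have "degree ([:- a, 1:] * g) \<le> n"
          using g(1) Suc.hyps degree_mult_le[of "[:- a, 1:]" g] by simp
        ultimately have "\<phi> ([:- a, 1:] * ([:- a, 1:] * g)) = 0"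
          unfolding B1_def by (auto simp del: mult_pCons_left)
        moreover have "[:- a, 1:] * ([:- a, 1:] * g) = [:0, 1:] * ([:0, 1:] * g)
            + smult (- 2 * a) ([:0, 1:] * g) + smult (a * a) g"
          by (simp add: algebra_simps smult_add_left flip: smult_add_left)
        ultimately have "\<phi> ([:0, 1:] * ([:0, 1:] * g)) + (- 2 * a) * \<phi> ([:0, 1:] * g) + (a * a) * \<phi> g = 0"
          by (metis add scl)
        then show "a \<in> {a. poly ?q a = 0}" by (simp add: algebra_simps)
      qed
      ultimately show ?thesis using poly_roots_finite finite_subset by blast
    qed
    ultimately have "finite (F \<union> B0 \<union> B1 \<union> (\<Union>y\<in>F. B2 y))"
      using Suc.prems(3) by simp
    from ex_new_if_finite[OF infinite_UNIV_char_0 this]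
    obtain a where a: "a \<notin> F \<union> B0 \<union> B1 \<union> (\<Union>y\<in>F. B2 y)" ..
    have "\<exists>Y e. finite Y \<and> card Y \<le> n \<and> Y \<inter> insert a F = {} \<and>
      (\<forall>f. degree f \<le> n \<longrightarrow> \<phi> ([:- a, 1:] * f) = (\<Sum>y\<in>Y. e y * poly f y))"
    proof (rule Suc.IH)
      show "\<phi> ([:- a, 1:] * (f + g)) = \<phi> ([:- a, 1:] * f) + \<phi> ([:- a, 1:] * g)" for f g
        by (simp only: distrib_left add)
      show "\<phi> ([:- a, 1:] * smult c f) = c * \<phi> ([:- a, 1:] * f)" for c f
        by (simp only: mult_smult_right scl)
      show "finite (insert a F)" using Suc.prems(3) by simp
      show "\<nexists>l. \<forall>f. degree f \<le> n \<longrightarrow> \<phi> ([:- a, 1:] * f) = l * coeff f n"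
        using a unfolding B0_def by blast
      show "\<nexists>l. \<forall>f. degree f \<le> n \<longrightarrow> \<phi> ([:- a, 1:] * f) = l * poly f y" if "y \<in> insert a F" for y
        using a that unfolding B1_def B2_def by blast
    qed
    then obtain Y e where Y: "finite Y" "card Y \<le> n" "Y \<inter> insert a F = {}"
      and e: "\<And>f. degree f \<le> n \<Longrightarrow> \<phi> ([:- a, 1:] * f) = (\<Sum>y\<in>Y. e y * poly f y)" by blast
    \<comment> \<open>Write \<open>f = (X - a) * h + f(a)\<close>, where
      \<open>h(y) = (f(y) - f(a)) / (y - a)\<close>. The old weights are divided by
      \<open>y - a\<close>, and all multiples of \<open>f(a)\<close>, including the one by
      \<open>\<phi> 1\<close>, are collected in the weight at the new point
      \<open>a\<close>.\<close>
    define e' where "e' y = (if y = a then \<phi> 1 - (\<Sum>y\<in>Y. e y / (y - a)) else e y / (y - a))" for y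
    have "\<phi> f = (\<Sum>y\<in>insert a Y. e' y * poly f y)" if "degree f \<le> Suc n" for f
    proof -
      let ?h = "synthetic_div f a"
      have f: "[:- a, 1:] * ?h + smult (poly f a) 1 = f"
        using synthetic_div_correct'[of a f] by simp
      have h: "poly ?h y = (poly f y - poly f a) / (y - a)" if "y \<in> Y" for y
      proof -
        have "poly f y = (y - a) * poly ?h y + poly f a"
          by (subst f[symmetric]) (simp add: algebra_simps)
        moreover have "y \<noteq> a" using that Y by blast
        ultimately show ?thesis by simp
      qed
      have "\<phi> f = \<phi> ([:- a, 1:] * ?h) + poly f a * \<phi> 1"
        by (metis f add scl)
      also have "\<phi> ([:- a, 1:] * ?h) = (\<Sum>y\<in>Y. e y * poly ?h y)"
        using that by (intro e) (simp add: degree_synthetic_div)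
      also have "\<dots> = (\<Sum>y\<in>Y. e y / (y - a) * poly f y) - poly f a * (\<Sum>y\<in>Y. e y / (y - a))"
        by (simp add: h sum_distrib_left sum_subtractf[symmetric] diff_divide_distrib algebra_simps)
      also have "(\<Sum>y\<in>Y. e y / (y - a) * poly f y) = (\<Sum>y\<in>Y. e' y * poly f y)"
        using Y by (intro sum.cong) (auto simp: e'_def)
      finally have "\<phi> f = (\<Sum>y\<in>Y. e' y * poly f y) + e' a * poly f a"
        by (simp add: e'_def algebra_simps)
      then show ?thesis using Y by simp
    qed
    then show ?thesis
      using Y a by (intro exI[of _ "insert a Y"] exI[of _ e']) (auto simp: card_insert_if)
  qed
qed

section \<open>Relations between powers of linear forms\<close>

lemma (in vector_space) dual_separates:
  assumes "x \<notin> span B"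
  obtains f where "f \<in> dual scale" "f x = 1" "\<And>b. b \<in> span B \<Longrightarrow> f b = 0"
proof -
  interpret K: vector_space "(*) :: 'a \<Rightarrow> 'a \<Rightarrow> 'a"
    by unfold_locales (simp_all add: distrib_left distrib_right)
  interpret P: vector_space_pair scale "(*) :: 'a \<Rightarrow> 'a \<Rightarrow> 'a" ..
  obtain C where C: "C \<subseteq> B" "independent C" "B \<subseteq> span C"
    using maximal_independent_subset[of B] by blast
  have sp: "span B = span C" using C by (metis span_mono span_span subset_antisym)
  then have "independent (insert x C)" "x \<notin> C"
    using assms C(2) by (auto simp: independent_insertI span_base)
  from P.linear_independent_extend[OF this(1), of "\<lambda>z. if z = x then 1 else 0"]
  obtain f where f: "Vector_Spaces.linear scale (*) f" "\<And>z. z \<in> insert x C \<Longrightarrow> f z = (if z = x then 1 else 0)"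
    by blast
  interpret f: Vector_Spaces.linear scale "(*)" f by (rule f)
  have "f b = 0" if "b \<in> span B" for b
  proof (rule f.eq_0_on_span)
    show "b \<in> span C" using that sp by simp
  qed (use f(2) \<open>x \<notin> C\<close> in auto)
  then show ?thesis using that f by (simp add: dual_def)
qed

text \<open>Take for each \<open>j\<close> a linear form that vanishes at \<open>x j\<close> and is
  1 at \<open>x0\<close>, and fill up to length \<open>d\<close> with copies of a form that is 1 at
  \<open>x0\<close>. Thus a form of degree \<open>d\<close> separates a point from any
  \<open>d\<close> others.\<close>

lemma (in vector_space) killing_list:
  assumes "finite J" "card J \<le> d" "x0 \<noteq> 0" "\<And>j. j \<in> J \<Longrightarrow> x0 \<notin> span {x j}"
  obtains fs where "fs \<in> dual_lists scale d" "(\<Prod>f\<leftarrow>fs. f x0) = 1"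
    "\<And>j. j \<in> J \<Longrightarrow> (\<Prod>f\<leftarrow>fs. f (x j)) = 0"
proof -
  have "\<exists>f. f \<in> dual scale \<and> f x0 = 1 \<and> f (x j) = 0" if "j \<in> J" for j
    using dual_separates[OF assms(4)[OF that]] span_base[of "x j" "{x j}"] by blast
  then obtain g where g: "\<And>j. j \<in> J \<Longrightarrow> g j \<in> dual scale \<and> g j x0 = 1 \<and> g j (x j) = 0" by metis
  have "x0 \<notin> span {}" using assms(3) by simp
  then obtain h where h: "h \<in> dual scale" "h x0 = 1" using dual_separates by metis
  obtain js where js: "set js = J" "distinct js" using finite_distinct_list[OF assms(1)] by blast
  let ?fs = "map g js @ replicate (d - card J) h"
  have "length js = card J" using js distinct_card by metis
  then have "?fs \<in> dual_lists scale d"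
    using g h js assms(2) by (auto simp: dual_lists_def)
  moreover have "(\<Prod>f\<leftarrow>?fs. f x0) = 1"
  proof -
    have "(\<Prod>f\<leftarrow>map g js. f x0) = 1" if "set js \<subseteq> J" for js
      using that g by (induction js) auto
    then show ?thesis using js h by (simp add: map_replicate_const[symmetric] prod_list_replicate)
  qed
  moreover have "(\<Prod>f\<leftarrow>?fs. f (x j)) = 0" if "j \<in> J" for j
    using that g js by (auto simp: prod_list_zero_iff image_iff)
  ultimately show ?thesis using that by blast
qed

section \<open>Linear relations between d-th powers of vectors\<close>

definition power_relation ::
    "('k::field \<Rightarrow> 'v::ab_group_add \<Rightarrow> 'v) \<Rightarrow> nat \<Rightarrow> 'i set \<Rightarrow> ('i \<Rightarrow> 'k) \<Rightarrow> ('i \<Rightarrow> 'v) \<Rightarrow> bool" where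
  "power_relation s d I c x \<longleftrightarrow>
    (\<forall>fs \<in> dual_lists s d. (\<Sum>i\<in>I. c i * (\<Prod>f\<leftarrow>fs. f (x i))) = 0)"

definition distinct_points :: "('k::field \<Rightarrow> 'v::ab_group_add \<Rightarrow> 'v) \<Rightarrow> 'i set \<Rightarrow> ('i \<Rightarrow> 'v) \<Rightarrow> bool" where
  "distinct_points s I x \<longleftrightarrow>
    (\<forall>i\<in>I. x i \<noteq> 0 \<and> (\<forall>j\<in>I. i \<noteq> j \<longrightarrow> x i \<notin> module.span s {x j}))"

text \<open>With at most \<open>d + 1\<close> points, some form of degree \<open>d\<close> vanishes
  at all of them but one, and the relation reduces to a single nonzero coefficient.\<close>

lemma (in vector_space) power_relation_card:
  assumes "finite I" "I \<noteq> {}" "distinct_points scale I x" "\<And>i. i \<in> I \<Longrightarrow> c i \<noteq> 0"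
    and rel: "power_relation scale d I c x"
  shows "d + 2 \<le> card I"
proof (rule ccontr)
  assume less: "\<not> ?thesis"
  obtain i where i: "i \<in> I" using assms(2) by blast
  have "card (I - {i}) \<le> d" using less i assms(1) by simp
  obtain fs where fs: "fs \<in> dual_lists scale d" "(\<Prod>f\<leftarrow>fs. f (x i)) = 1"
    "\<And>j. j \<in> I - {i} \<Longrightarrow> (\<Prod>f\<leftarrow>fs. f (x j)) = 0"
    by (rule killing_list[of "I - {i}" d "x i" x])
      (use \<open>card (I - {i}) \<le> d\<close> assms(1,3) i in \<open>auto simp: distinct_points_def\<close>)
  have "(\<Sum>i\<in>I. c i * (\<Prod>f\<leftarrow>fs. f (x i))) = c i"
    using i assms(1) fs by (subst sum.remove[of _ i]) auto
  then show False using rel fs(1) assms(4)[OF i] unfolding power_relation_def by simp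
qed

text \<open>Contraction with \<open>f\<close> lowers the degree by one and drops exactly the points
  on the hyperplane \<open>f = 0\<close>, so nonzero coefficients remain nonzero.\<close>

lemma power_relation_Cons:
  assumes "finite I" "power_relation s (Suc d) I c x" "f \<in> dual s"
  shows "power_relation s d {i \<in> I. f (x i) \<noteq> 0} (\<lambda>i. c i * f (x i)) x"
  unfolding power_relation_def
proof
  fix fs assume fs: "fs \<in> dual_lists s d"
  then have "f # fs \<in> dual_lists s (Suc d)" using assms(3) by (simp add: dual_lists_def)
  then have "(\<Sum>i\<in>I. c i * (\<Prod>f\<leftarrow>f # fs. f (x i))) = 0"
    using assms(2) unfolding power_relation_def by blast
  moreover have "(\<Sum>i\<in>I. c i * (\<Prod>f\<leftarrow>f # fs. f (x i))) =
      (\<Sum>i | i \<in> I \<and> f (x i) \<noteq> 0. c i * f (x i) * (\<Prod>f\<leftarrow>fs. f (x i)))"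
    using assms(1) by (intro sum.mono_neutral_cong_right) auto
  ultimately show "(\<Sum>i | i \<in> I \<and> f (x i) \<noteq> 0. c i * f (x i) * (\<Prod>f\<leftarrow>fs. f (x i))) = 0"
    by simp
qed

lemma distinct_points_subset: "distinct_points s I x \<Longrightarrow> J \<subseteq> I \<Longrightarrow> distinct_points s J x"
  unfolding distinct_points_def by blast

text \<open>Induction on the degree. If the points are not collinear, contracting with a hyperplane
  through two of them but not through a third leaves points on one line, by induction. Contracting
  with a hyperplane that contains this line but misses another point leaves a set disjoint from the
  first. In degree \<open>Suc d\<close> both sets carry relations of degree \<open>d\<close>, so
  each has at least \<open>d + 2\<close> elements; that is more than the \<open>2 * d + 3\<close>
  points available.\<close>

lemma (in vector_space) power_relation_collinear:
  assumes "finite I" "distinct_points scale I x" "\<And>i. i \<in> I \<Longrightarrow> c i \<noteq> 0"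
    and "power_relation scale d I c x" "card I \<le> 2 * d + 1"
  shows "\<exists>u v. x ` I \<subseteq> span {u, v}"
  using assms
proof (induction d arbitrary: I c)
  case 0
  then have "card I \<le> 1" by simp
  then have "I = {}" using power_relation_card[of I x c 0] 0 by force
  then show ?case by simp
next
  case (Suc d)
  show ?case
  proof (rule ccontr)
    assume no: "\<not> ?case"
    have step: "d + 2 \<le> card {i \<in> I. f (x i) \<noteq> 0}" if "f \<in> dual scale" "i \<in> I" "f (x i) \<noteq> 0" for f i
      using power_relation_card[OF _ _ distinct_points_subset[OF Suc.prems(2)] _
          power_relation_Cons[OF Suc.prems(1,4) that(1)]] that Suc.prems(1,3) by auto
    have "\<not> (\<exists>u. x ` I \<subseteq> {u})" using no span_superset by (metis insert_absorb2 subset_trans)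
    then obtain i j where ij: "i \<in> I" "j \<in> I" "x i \<noteq> x j" by (metis image_subset_iff singletonI insertI1)
    then obtain k where k: "k \<in> I" "x k \<notin> span {x i, x j}" using no by (metis image_subsetI)
    obtain f where f: "f \<in> dual scale" "f (x k) = 1" "f (x i) = 0" "f (x j) = 0"
      using dual_separates[OF k(2)] span_base by (metis insertI1 insert_commute)
    let ?J = "{i \<in> I. f (x i) \<noteq> 0}"
    have "?J \<subseteq> I - {i, j}" using f by auto
    then have "card ?J \<le> card (I - {i, j})" using Suc.prems(1) by (intro card_mono) auto
    also have "\<dots> = card I - 2" using ij by (cases "i = j") (auto simp: card_Diff_subset)
    finally have "card ?J \<le> 2 * d + 1" using Suc.prems(5) by simp
    then obtain u v where uv: "x ` ?J \<subseteq> span {u, v}"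
      using Suc.IH[OF _ distinct_points_subset[OF Suc.prems(2)] _ power_relation_Cons[OF Suc.prems(1,4) f(1)]]
        Suc.prems(1,3) by force
    obtain l where l: "l \<in> I" "x l \<notin> span {u, v}" using no by (metis image_subsetI)
    obtain g where g: "g \<in> dual scale" "g (x l) = 1" "\<And>b. b \<in> span {u, v} \<Longrightarrow> g b = 0"
      using dual_separates[OF l(2)] by metis
    let ?L = "{i \<in> I. g (x i) \<noteq> 0}"
    have "?J \<inter> ?L = {}" using uv g(3) by auto
    then have "card (?J \<union> ?L) = card ?J + card ?L" using Suc.prems(1) by (intro card_Un_disjoint) auto
    moreover have "card (?J \<union> ?L) \<le> card I" using Suc.prems(1) by (intro card_mono) auto
    moreover have "d + 2 \<le> card ?J" using step[OF f(1) k(1)] f(2) by simp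
    moreover have "d + 2 \<le> card ?L" using step[OF g(1) l(1)] g(2) by simp
    ultimately show False using Suc.prems(5) by simp
  qed
qed

text \<open>On the span of \<open>u\<close> and \<open>v\<close> a product of \<open>d\<close>
  functionals is a binary form. Dehomogenized along \<open>u + t v\<close> it becomes a polynomial
  in \<open>t\<close>; the direction \<open>v\<close> is the point at infinity, where evaluation
  means taking the coefficient of degree \<open>d\<close>.\<close>

lemma (in vector_space) prod_dual_homogenize:
  assumes "fs \<in> dual_lists scale d"
  shows "(\<Prod>f\<leftarrow>fs. f (scale \<alpha> u + scale \<beta> v)) =
    (if \<alpha> = 0 then \<beta> ^ d * coeff (\<Prod>f\<leftarrow>fs. [:f u, f v:]) d
     else \<alpha> ^ d * poly (\<Prod>f\<leftarrow>fs. [:f u, f v:]) (\<beta> / \<alpha>))"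
  and "degree (\<Prod>f\<leftarrow>fs. [:f u, f v:]) \<le> d"
  and "coeff (\<Prod>f\<leftarrow>fs. [:f u, f v:]) d = (\<Prod>f\<leftarrow>fs. f v)"
  and "poly (\<Prod>f\<leftarrow>fs. [:f u, f v:]) t = (\<Prod>f\<leftarrow>fs. f (u + scale t v))"
proof -
  let ?g = "\<lambda>fs. \<Prod>f\<leftarrow>fs. [:f u, f v:]"
  have "degree (?g fs) \<le> length fs" for fs
  proof (induction fs)
    case (Cons f fs)
    have "degree (?g (f # fs)) \<le> degree [:f u, f v:] + degree (?g fs)"
      using degree_mult_le[of "[:f u, f v:]" "?g fs"] by (simp only: list.map prod_list.Cons)
    also have "\<dots> \<le> Suc (length fs)" using Cons by (simp split: if_splits)
    finally show ?case by simp
  qed simp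
  note deg = this
  have len: "length fs = d" "set fs \<subseteq> dual scale" using assms by (auto simp: dual_lists_def)
  then show "degree (?g fs) \<le> d" using deg by blast
  have co: "coeff (?g fs) (length fs) = (\<Prod>f\<leftarrow>fs. f v)" for fs
  proof (induction fs)
    case (Cons f fs)
    then show ?case using deg[of fs] by (simp add: coeff_eq_0)
  qed simp
  from co[of fs] show coe: "coeff (?g fs) d = (\<Prod>f\<leftarrow>fs. f v)" by (simp only: len)
  have po: "poly (?g fs) t = (\<Prod>f\<leftarrow>fs. f (u + scale t v))" if "set fs \<subseteq> dual scale" for fs t
    using that by (induction fs) (auto simp: dual_iff distrib_right mult.assoc)
  from po[OF len(2)] show "poly (?g fs) t = (\<Prod>f\<leftarrow>fs. f (u + scale t v))" .
  have hom: "(\<Prod>f\<leftarrow>fs. f (scale a w)) = a ^ d * (\<Prod>f\<leftarrow>fs. f w)" for a w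
    using tensor_power_scale[of scale d a w fs] assms by (simp add: tensor_power_def)
  show "(\<Prod>f\<leftarrow>fs. f (scale \<alpha> u + scale \<beta> v)) =
    (if \<alpha> = 0 then \<beta> ^ d * coeff (?g fs) d else \<alpha> ^ d * poly (?g fs) (\<beta> / \<alpha>))"
  proof (cases "\<alpha> = 0")
    case False
    then have "scale \<alpha> u + scale \<beta> v = scale \<alpha> (u + scale (\<beta> / \<alpha>) v)"
      by (simp add: scale_right_distrib)
    then show ?thesis using False by (simp only: po[OF len(2)] hom if_False)
  qed (simp add: hom coe)
qed

text \<open>The classical bound on the rank of a binary form of degree \<open>d\<close>. The sum
  over \<open>I\<close> factors through a functional on polynomials of degree at most
  \<open>d\<close>, and each evaluation in a decomposition of this functional is one power.\<close>

lemma binary_rank_le_degree: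
  fixes s :: "'k::field_char_0 \<Rightarrow> 'v::ab_group_add \<Rightarrow> 'v"
  assumes "vector_space s" "finite I" "x ` I \<subseteq> module.span s {u, v}" "d \<ge> 1"
  obtains Y :: "'k set" and e y where "finite Y" "card Y \<le> d"
    "\<And>fs. fs \<in> dual_lists s d \<Longrightarrow>
      (\<Sum>i\<in>I. c i * (\<Prod>f\<leftarrow>fs. f (x i))) = (\<Sum>j\<in>Y. e j * (\<Prod>f\<leftarrow>fs. f (y j)))"
proof -
  interpret vector_space s by fact
  have "\<exists>\<alpha> \<beta>. x i = s \<alpha> u + s \<beta> v" if "i \<in> I" for i
    using that assms(3) unfolding image_subset_iff span_insert span_singleton
    by (auto simp: eq_diff_eq) (metis add.commute diff_add_cancel)
  then obtain \<alpha> \<beta> where x: "\<And>i. i \<in> I \<Longrightarrow> x i = s (\<alpha> i) u + s (\<beta> i) v" by metis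
  define \<phi> where "\<phi> g = (\<Sum>i\<in>I. c i *
    (if \<alpha> i = 0 then \<beta> i ^ d * coeff g d else \<alpha> i ^ d * poly g (\<beta> i / \<alpha> i)))" for g
  let ?g = "\<lambda>fs. \<Prod>f\<leftarrow>fs. [:f u, f v:]"
  have \<phi>: "(\<Sum>i\<in>I. c i * (\<Prod>f\<leftarrow>fs. f (x i))) = \<phi> (?g fs)" if "fs \<in> dual_lists s d" for fs
    unfolding \<phi>_def by (intro sum.cong refl arg_cong2[of _ _ _ _ "(*)"]) (simp only: x prod_dual_homogenize(1)[OF that])
  show ?thesis
  proof (cases "\<exists>l. \<forall>f. degree f \<le> d \<longrightarrow> \<phi> f = l * coeff f d")
    case True
    then obtain l where l: "\<And>f. degree f \<le> d \<Longrightarrow> \<phi> f = l * coeff f d" by blast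
    \<comment> \<open>Evaluation at infinity is the single power of \<open>v\<close>. The element
      \<open>0\<close> is only a label for the one summand, which the bound admits because
      \<open>d \<ge> 1\<close>.\<close>
    show ?thesis
      by (rule that[of "{0}" "\<lambda>_. l" "\<lambda>_. v"])
        (use assms(4) in \<open>simp_all add: \<phi> l prod_dual_homogenize(2,3)\<close>)
  next
    case False
    have "\<exists>Y e. finite Y \<and> card Y \<le> d \<and> Y \<inter> {} = {} \<and>
        (\<forall>f. degree f \<le> d \<longrightarrow> \<phi> f = (\<Sum>y\<in>Y. e y * poly f y))"
      by (rule apolar_finite_evaluations)
        (use assms(4) False in \<open>auto simp: \<phi>_def sum.distrib[symmetric] sum_distrib_left algebra_simps intro!: sum.cong\<close>)
    then obtain Y e where Y: "finite Y" "card Y \<le> d"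
      "\<And>f. degree f \<le> d \<Longrightarrow> \<phi> f = (\<Sum>y\<in>Y. e y * poly f y)" by blast
    show ?thesis
      by (rule that[of Y e "\<lambda>t. u + s t v"]) (use Y in \<open>simp_all add: \<phi> prod_dual_homogenize(2,4)\<close>)
  qed
qed

section \<open>Minimal decompositions\<close>

definition representative :: "('k::field \<Rightarrow> 'v::ab_group_add \<Rightarrow> 'v) \<Rightarrow> 'v set \<Rightarrow> 'v" where
  "representative s P = (SOME v. v \<noteq> 0 \<and> P = proj_pt s v)"

lemma representative:
  assumes "P \<in> proj_space s"
  shows "representative s P \<noteq> 0" "proj_pt s (representative s P) = P"
proof -
  have "\<exists>v. v \<noteq> 0 \<and> P = proj_pt s v" using assms by (auto simp: proj_space_def)
  from someI_ex[OF this] show "representative s P \<noteq> 0" "proj_pt s (representative s P) = P"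
    unfolding representative_def by auto
qed

lemma (in vector_space) subset_iff_representative:
  assumes "P \<in> proj_space scale" "subspace U"
  shows "P \<subseteq> U \<longleftrightarrow> representative scale P \<in> U"
proof -
  have P: "P = span {representative scale P}" using representative(2)[OF assms(1)] by (simp add: proj_pt_def)
  show ?thesis using assms(2) P span_base[of "representative scale P"] span_minimal[of "{representative scale P}" U]
    by (metis empty_subsetI insertI1 insert_subset subset_iff)
qed

lemma (in vector_space) distinct_points_representative:
  assumes "X \<subseteq> proj_space scale"
  shows "distinct_points scale X (representative scale)"
  unfolding distinct_points_def
proof (intro ballI conjI impI)
  fix P Q assume PQ: "P \<in> X" "Q \<in> X" "P \<noteq> Q"
  let ?v = "representative scale P" and ?w = "representative scale Q"
  have P: "P = span {?v}" "?v \<noteq> 0" and Q: "Q = span {?w}"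
    using PQ assms representative[of _ scale] unfolding proj_pt_def by (metis subset_iff)+
  show "?v \<notin> span {?w}"
  proof
    assume *: "?v \<in> span {?w}"
    then have "?w \<in> span {?v}" using in_span_insert[of ?v ?w "{}"] P(2) by simp
    then have "span {?v} = span {?w}"
      using * by (simp add: span_eq)
    then show False using P Q PQ by simp
  qed
qed (use assms representative in auto)

text \<open>The index type is arbitrary, because sums indexed by numbers, by pairs of projective
  points and by disjoint sums of index sets are compared with each other.\<close>

definition tensor_sum ::
    "('k::field \<Rightarrow> 'v::ab_group_add \<Rightarrow> 'v) \<Rightarrow> ('k \<Rightarrow> 'w::ab_group_add \<Rightarrow> 'w) \<Rightarrow> nat \<Rightarrow> nat \<Rightarrow>
      'i set \<Rightarrow> ('i \<Rightarrow> 'k) \<Rightarrow> ('i \<Rightarrow> 'v) \<Rightarrow> ('i \<Rightarrow> 'w) \<Rightarrow> ('v, 'w, 'k) tensor" where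
  "tensor_sum s1 s2 d1 d2 I a x y =
    (\<lambda>fs gs. \<Sum>i\<in>I. a i * (tensor_power s1 d1 (x i) fs * tensor_power s2 d2 (y i) gs))"

lemma tensor_sum_eq:
  "tensor_sum s1 s2 d1 d2 I a x y =
    (\<Sum>i\<in>I. tensor_scale (a i) (rank_one_tensor s1 s2 d1 d2 (x i) (y i)))"
  by (induction I rule: infinite_finite_induct)
    (auto simp: tensor_sum_def tensor_scale_def rank_one_tensor_def fun_eq_iff)

lemma tensor_rank_eq:
  "tensor_rank s1 s2 d1 d2 p = (LEAST r. \<exists>c v w. p = tensor_sum s1 s2 d1 d2 {..<r} c v w)"
  unfolding tensor_rank_def tensor_sum_eq ..

lemma tensor_rank_le:
  assumes "finite I" "p = tensor_sum s1 s2 d1 d2 I a x y"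
  shows "tensor_rank s1 s2 d1 d2 p \<le> card I"
proof -
  obtain h where h: "bij_betw h {..<card I} I"
    using ex_bij_betw_nat_finite[OF assms(1)] by (auto simp: atLeast0LessThan)
  have "p = tensor_sum s1 s2 d1 d2 {..<card I} (a \<circ> h) (x \<circ> h) (y \<circ> h)"
    unfolding assms(2) tensor_sum_def fun_eq_iff by (auto simp: sum.reindex_bij_betw[OF h, symmetric])
  then show ?thesis unfolding tensor_rank_eq by (intro Least_le) blast
qed

text \<open>Exchanging the factors turns \<alpha>-lines into \<beta>-lines, so that the geometric
  arguments are given for \<beta>-lines only.\<close>

definition swap_tensor :: "('v, 'w, 'k) tensor \<Rightarrow> ('w, 'v, 'k) tensor" where
  "swap_tensor p = (\<lambda>gs fs. p fs gs)"

lemma swap_tensor_sum: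
  "swap_tensor (tensor_sum s1 s2 d1 d2 I a x y) = tensor_sum s2 s1 d2 d1 I a y x"
  by (simp add: swap_tensor_def tensor_sum_def mult.commute)

lemma swap_tensor_swap: "swap_tensor (swap_tensor p) = p"
  by (simp add: swap_tensor_def)

lemma tensor_rank_swap:
  "tensor_rank s2 s1 d2 d1 (swap_tensor p) = tensor_rank s1 s2 d1 d2 p"
proof -
  have "(\<exists>c v w. swap_tensor p = tensor_sum s2 s1 d2 d1 {..<r} c v w) \<longleftrightarrow>
      (\<exists>c v w. p = tensor_sum s1 s2 d1 d2 {..<r} c v w)" for r
    by (metis swap_tensor_sum swap_tensor_swap)
  then show ?thesis unfolding tensor_rank_eq by (intro arg_cong[of _ _ Least] ext)
qed

section \<open>Decompositions as explicit sums over points\<close>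

lemma (in vector_space) span_image_finite_sum:
  assumes "finite I"
  shows "q \<in> span (t ` I) \<longleftrightarrow> (\<exists>a. q = (\<Sum>i\<in>I. scale (a i) (t i)))"
proof
  assume "q \<in> span (t ` I)"
  with assms show "\<exists>a. q = (\<Sum>i\<in>I. scale (a i) (t i))"
  proof (induction I arbitrary: q)
    case (insert j I)
    then obtain k where "q - scale k (t j) \<in> span (t ` I)" by (auto simp: span_breakdown_eq)
    then obtain a where a: "q - scale k (t j) = (\<Sum>i\<in>I. scale (a i) (t i))" using insert.IH by blast
    have "q = (\<Sum>i\<in>insert j I. scale ((a(j := k)) i) (t i))"
    proof -
      have "(\<Sum>i\<in>I. scale ((a(j := k)) i) (t i)) = (\<Sum>i\<in>I. scale (a i) (t i))"
        using insert.hyps by (intro sum.cong) auto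
      then show ?thesis using insert.hyps a by (simp add: eq_diff_eq diff_eq_eq)
    qed
    then show ?case by blast
  qed simp
qed (auto intro!: span_sum span_scale intro: span_base)

lemma proj_pt_in_proj_span:
  assumes "vector_space s" "q \<noteq> 0"
  shows "proj_pt s q \<in> proj_span s X \<longleftrightarrow> q \<in> module.span s (\<Union>X)"
proof -
  interpret vector_space s by fact
  have "span {q} \<subseteq> span (\<Union>X) \<longleftrightarrow> q \<in> span (\<Union>X)"
    using span_base[of q "{q}"] span_minimal[of "{q}" "span (\<Union>X)"] by auto
  then show ?thesis using assms(2) by (auto simp: proj_span_def proj_space_def proj_pt_def)
qed

lemma span_segre_veronese:
  assumes "vector_space s1" "vector_space s2" "S \<subseteq> proj_space s1 \<times> proj_space s2"
  shows "module.span tensor_scale (\<Union>(segre_veronese s1 s2 d1 d2 ` S)) =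
    module.span tensor_scale ((\<lambda>z. rank_one_tensor s1 s2 d1 d2
      (representative s1 (fst z)) (representative s2 (snd z))) ` S)" (is "_ = module.span _ (?t ` S)")
proof -
  interpret T: vector_space tensor_scale by (rule vector_space_tensor_scale)
  have sv: "segre_veronese s1 s2 d1 d2 z = T.span {?t z}" if "z \<in> S" for z
  proof -
    have "fst z \<in> proj_space s1" "snd z \<in> proj_space s2" using that assms(3) by auto
    then show ?thesis
      using segre_veronese_proj_pt[OF assms(1,2), of d1 d2 "representative s1 (fst z)" "representative s2 (snd z)"]
      by (simp add: representative(2)) (simp add: proj_pt_def)
  qed
  have "\<Union>(segre_veronese s1 s2 d1 d2 ` S) \<subseteq> T.span (?t ` S)"
  proof (rule UN_least)
    fix z assume "z \<in> S"
    then show "segre_veronese s1 s2 d1 d2 z \<subseteq> T.span (?t ` S)"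
      unfolding sv[OF \<open>z \<in> S\<close>] by (intro T.span_mono) simp
  qed
  moreover have "?t ` S \<subseteq> T.span (\<Union>(segre_veronese s1 s2 d1 d2 ` S))"
  proof (rule image_subsetI)
    fix z assume "z \<in> S"
    then have "?t z \<in> \<Union>(segre_veronese s1 s2 d1 d2 ` S)"
      using sv[OF \<open>z \<in> S\<close>] T.span_base[of "?t z" "{?t z}"] by (intro UN_I[OF \<open>z \<in> S\<close>]) simp
    then show "?t z \<in> T.span (\<Union>(segre_veronese s1 s2 d1 d2 ` S))" by (rule T.span_base)
  qed
  ultimately show ?thesis by (intro iffD2[OF T.span_eq] conjI)
qed

abbreviation decomp_sum where
  "decomp_sum s1 s2 d1 d2 S a \<equiv> tensor_sum s1 s2 d1 d2 S a
    (\<lambda>z. representative s1 (fst z)) (\<lambda>z. representative s2 (snd z))"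

text \<open>With fixed representatives, membership in the projective span becomes the existence of
  coefficients; in this form two decompositions can be subtracted and parts of one can be
  replaced.\<close>

lemma min_decomps_iff:
  assumes "vector_space s1" "vector_space s2" "p \<noteq> 0"
  shows "S \<in> min_decomps s1 s2 d1 d2 p \<longleftrightarrow>
    finite S \<and> S \<subseteq> proj_space s1 \<times> proj_space s2 \<and> card S = tensor_rank s1 s2 d1 d2 p \<and>
    (\<exists>a. p = decomp_sum s1 s2 d1 d2 S a)"
proof -
  interpret T: vector_space tensor_scale by (rule vector_space_tensor_scale)
  have "proj_pt tensor_scale p \<in> proj_span tensor_scale (segre_veronese s1 s2 d1 d2 ` S) \<longleftrightarrow>
      (\<exists>a. p = decomp_sum s1 s2 d1 d2 S a)" if "finite S" "S \<subseteq> proj_space s1 \<times> proj_space s2"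
    unfolding proj_pt_in_proj_span[OF vector_space_tensor_scale assms(3)]
      span_segre_veronese[OF assms(1,2) that(2)] T.span_image_finite_sum[OF that(1)] tensor_sum_eq ..
  then show ?thesis unfolding min_decomps_def by auto
qed

lemma swap_min_decomps:
  assumes "vector_space s1" "vector_space s2" "p \<noteq> 0" "S \<in> min_decomps s1 s2 d1 d2 p"
  shows "prod.swap ` S \<in> min_decomps s2 s1 d2 d1 (swap_tensor p)"
proof -
  have S: "finite S" "S \<subseteq> proj_space s1 \<times> proj_space s2" "card S = tensor_rank s1 s2 d1 d2 p"
    using assms min_decomps_iff by blast+
  obtain a where a: "p = decomp_sum s1 s2 d1 d2 S a" using assms min_decomps_iff by blast
  have "swap_tensor p = decomp_sum s2 s1 d2 d1 (prod.swap ` S) (a \<circ> prod.swap)"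
    by (subst a) (simp add: swap_tensor_def tensor_sum_def sum.reindex mult.commute)
  moreover have "swap_tensor p \<noteq> 0"
    using assms(3) by (auto simp: swap_tensor_def fun_eq_iff)
  moreover have "card (prod.swap ` S) = tensor_rank s2 s1 d2 d1 (swap_tensor p)"
    by (simp add: card_image S(3) tensor_rank_swap)
  ultimately show ?thesis
    using S by (subst min_decomps_iff[OF assms(2,1)]) auto
qed

lemma minimal_coeff_nonzero:
  assumes "finite I" "card I = tensor_rank s1 s2 d1 d2 p" "p = tensor_sum s1 s2 d1 d2 I a x y" "i \<in> I"
  shows "a i \<noteq> 0"
proof
  assume "a i = 0"
  then have "p = tensor_sum s1 s2 d1 d2 (I - {i}) a x y"
    unfolding assms(3) tensor_sum_def using assms(1,4) by (simp add: sum.remove[of I i])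
  then have "card I \<le> card (I - {i})" using tensor_rank_le[OF finite_Diff[OF assms(1)]] assms(2) by metis
  then show False using assms(1,4) by (metis card_Diff1_less leD)
qed

text \<open>The summands over \<open>J\<close> have the common first factor \<open>x0\<close>, and
  their second factors add up to a binary form of degree \<open>d2\<close>. Rewriting this form with
  at most \<open>d2\<close> powers must not shorten the minimal decomposition.\<close>

lemma minimal_fibre_card:
  fixes s2 :: "'k::field_char_0 \<Rightarrow> 'w::ab_group_add \<Rightarrow> 'w"
  assumes "vector_space s2" "finite I" "card I = tensor_rank s1 s2 d1 d2 p"
    and p: "p = tensor_sum s1 s2 d1 d2 I a x y"
    and J: "J \<subseteq> I" "\<And>j. j \<in> J \<Longrightarrow> x j = x0" "y ` J \<subseteq> module.span s2 {u, v}" and "d2 \<ge> 1"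
  shows "card J \<le> d2"
proof -
  have J_fin: "finite J" using J(1) assms(2) finite_subset by blast
  obtain Y :: "'k set" and e y' where Y: "finite Y" "card Y \<le> d2"
    "\<And>gs. gs \<in> dual_lists s2 d2 \<Longrightarrow>
      (\<Sum>j\<in>J. a j * (\<Prod>g\<leftarrow>gs. g (y j))) = (\<Sum>j\<in>Y. e j * (\<Prod>g\<leftarrow>gs. g (y' j)))"
    by (rule binary_rank_le_degree[OF assms(1) J_fin J(3) \<open>d2 \<ge> 1\<close>, of a]) (rule that)
  have tp: "(\<Sum>j\<in>J. a j * tensor_power s2 d2 (y j) gs) = (\<Sum>j\<in>Y. e j * tensor_power s2 d2 (y' j) gs)" for gs
    using Y(3)[of gs] by (cases "gs \<in> dual_lists s2 d2") (simp_all add: tensor_power_def)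
  have eq: "(\<Sum>j\<in>J. a j * (tensor_power s1 d1 (x j) fs * tensor_power s2 d2 (y j) gs)) =
      (\<Sum>j\<in>Y. e j * (tensor_power s1 d1 x0 fs * tensor_power s2 d2 (y' j) gs))" for fs gs
  proof -
    have "(\<Sum>j\<in>J. a j * (tensor_power s1 d1 (x j) fs * tensor_power s2 d2 (y j) gs)) =
        tensor_power s1 d1 x0 fs * (\<Sum>j\<in>J. a j * tensor_power s2 d2 (y j) gs)"
      by (auto simp: sum_distrib_left J(2) mult.left_commute intro!: sum.cong)
    also have "\<dots> = (\<Sum>j\<in>Y. e j * (tensor_power s1 d1 x0 fs * tensor_power s2 d2 (y' j) gs))"
      by (auto simp: tp sum_distrib_left mult.left_commute intro!: sum.cong)
    finally show ?thesis .
  qed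
  \<comment> \<open>The new summands are indexed by scalars and the old ones by \<open>I\<close>,
    hence the disjoint sum of index sets.\<close>
  have "p = tensor_sum s1 s2 d1 d2 ((I - J) <+> Y) (case_sum a e) (case_sum x (\<lambda>_. x0)) (case_sum y y')"
    unfolding p tensor_sum_def
    by (intro ext) (simp add: sum.subset_diff[OF J(1) assms(2)] eq sum.Plus assms(2) Y(1))
  then have "tensor_rank s1 s2 d1 d2 p \<le> card ((I - J) <+> Y)"
    by (intro tensor_rank_le) (simp add: assms(2) Y(1))
  then have "card I \<le> card (I - J) + card Y"
    using assms(2,3) Y(1) by (simp add: card_Plus)
  moreover have "card (I - J) = card I - card J" "card J \<le> card I"
    using J(1) assms(2) J_fin by (simp_all add: card_Diff_subset card_mono)
  ultimately show ?thesis using Y(2) by linarith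
qed

section \<open>Lines and relations in two factors\<close>

lemma (in vector_space) span_pair_eq_subspace:
  assumes "subspace U" "dim U = 2" "u \<in> U" "v \<in> U" "u \<notin> span {v}" "v \<noteq> 0"
  shows "U = span {u, v}"
proof
  show "span {u, v} \<subseteq> U" using assms by (intro span_minimal) auto
  show "U \<subseteq> span {u, v}"
  proof (rule subsetI, rule ccontr)
    fix w assume w: "w \<in> U" "w \<notin> span {u, v}"
    obtain B where B: "B \<subseteq> U" "independent B" "U \<subseteq> span B" "card B = 2"
      using basis_exists[of U] assms(2) by metis
    then have "finite B" using card.infinite by fastforce
    have uv: "independent {u, v}" using assms(5,6) by (intro independent_insertI) (auto simp: independent_empty)
    then have "independent {w, u, v}" using w(2) by (rule independent_insertI[rotated])
    moreover have "{w, u, v} \<subseteq> span B" using w assms B by auto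
    ultimately have "card {w, u, v} \<le> card B"
      using independent_span_bound[OF \<open>finite B\<close>] by blast
    moreover have "w \<noteq> u" "w \<noteq> v" "u \<noteq> v" using w assms span_base[of u "{u, v}"] span_base[of v "{u, v}"] span_base[of v "{v}"] by auto
    then have "card {w, u, v} = 3" by simp
    ultimately show False using B(4) by simp
  qed
qed

lemma proj_line_unique:
  assumes "vector_space s" "proj_line s R" "proj_line s R'" "{P, Q} \<subseteq> R \<inter> R'" "P \<noteq> Q"
  shows "R = R'"
proof -
  interpret vector_space s by fact
  obtain U where U: "subspace U" "dim U = 2" "R = {P \<in> proj_space s. P \<subseteq> U}"
    using assms(2) unfolding proj_line_def by blast
  obtain U' where U': "subspace U'" "dim U' = 2" "R' = {P \<in> proj_space s. P \<subseteq> U'}"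
    using assms(3) unfolding proj_line_def by blast
  have PQ: "P \<in> proj_space s" "Q \<in> proj_space s" using assms(4) U(3) by auto
  have "representative s P \<notin> span {representative s Q}" "representative s Q \<noteq> 0"
    using distinct_points_representative[of "{P, Q}"] PQ assms(5) unfolding distinct_points_def by auto
  moreover have "representative s P \<in> U" "representative s Q \<in> U" "representative s P \<in> U'" "representative s Q \<in> U'"
    using assms(4) U(3) U'(3) PQ subset_iff_representative[OF _ U(1)] subset_iff_representative[OF _ U'(1)] by auto
  ultimately have "U = U'"
    using span_pair_eq_subspace[OF U(1,2)] span_pair_eq_subspace[OF U'(1,2)] by metis
  then show ?thesis using U U' by simp
qed

text \<open>A span of two vectors may have dimension less than 2; the two different points
  \<open>P\<close> and \<open>Q\<close> of \<open>X\<close> rule this out.\<close>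

lemma (in vector_space) collinear_points:
  assumes "X \<subseteq> proj_space scale" "P \<in> X" "Q \<in> X" "P \<noteq> Q" "representative scale ` X \<subseteq> span {u, v}"
  shows "proj_line scale {R \<in> proj_space scale. R \<subseteq> span {u, v}}" "X \<subseteq> {R \<in> proj_space scale. R \<subseteq> span {u, v}}"
proof -
  let ?r = "representative scale"
  have "?r P \<notin> span {?r Q}" "?r Q \<noteq> 0"
    using distinct_points_representative[OF assms(1)] assms(2-4) unfolding distinct_points_def by auto
  then have ind: "independent {?r P, ?r Q}" by (intro independent_insertI) (auto simp: independent_empty)
  have ne: "?r P \<noteq> ?r Q" using \<open>?r P \<notin> span {?r Q}\<close> span_base[of "?r Q" "{?r Q}"] by auto
  obtain B where B: "B \<subseteq> span {u, v}" "independent B" "span {u, v} \<subseteq> span B" "card B = dim (span {u, v})"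
    using basis_exists by metis
  have B2: "finite B" "card B \<le> card {u, v}"
    using independent_span_bound[OF _ B(2,1)] by auto
  have "card {?r P, ?r Q} \<le> card B"
    using independent_span_bound[OF B2(1) ind] assms(2,3,5) B(3) by auto
  moreover have "card {u, v} \<le> 2" by (simp add: card_insert_if)
  ultimately have "dim (span {u, v}) = 2" using B2(2) B(4) ne by simp
  then show "proj_line scale {R \<in> proj_space scale. R \<subseteq> span {u, v}}"
    unfolding proj_line_def using subspace_span by blast
  show "X \<subseteq> {R \<in> proj_space scale. R \<subseteq> span {u, v}}"
  proof
    fix R assume "R \<in> X"
    then have "R \<in> proj_space scale" "representative scale R \<in> span {u, v}" using assms(1,5) by auto
    then show "R \<in> {R \<in> proj_space scale. R \<subseteq> span {u, v}}"
      by (simp add: subset_iff_representative[OF _ subspace_span])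
  qed
qed

section \<open>Linear relations between products of powers in two factors\<close>

definition bipower_relation ::
    "('k::field \<Rightarrow> 'v::ab_group_add \<Rightarrow> 'v) \<Rightarrow> ('k \<Rightarrow> 'w::ab_group_add \<Rightarrow> 'w) \<Rightarrow> nat \<Rightarrow> nat \<Rightarrow>
      'i set \<Rightarrow> ('i \<Rightarrow> 'k) \<Rightarrow> ('i \<Rightarrow> 'v) \<Rightarrow> ('i \<Rightarrow> 'w) \<Rightarrow> bool" where
  "bipower_relation s1 s2 d1 d2 I c x y \<longleftrightarrow>
    (\<forall>fs \<in> dual_lists s1 d1. \<forall>gs \<in> dual_lists s2 d2.
      (\<Sum>i\<in>I. c i * ((\<Prod>f\<leftarrow>fs. f (x i)) * (\<Prod>g\<leftarrow>gs. g (y i)))) = 0)"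

lemma bipower_relation_swap:
  "bipower_relation s1 s2 d1 d2 I c x y \<Longrightarrow> bipower_relation s2 s1 d2 d1 I c y x"
  unfolding bipower_relation_def by (simp add: mult.commute)

text \<open>Contract the first factor with a product of functionals that is 1 at \<open>x0\<close>,
  supplied by \<open>killing_list\<close> with no points to kill.\<close>

lemma bipower_relation_fibre:
  assumes "vector_space s1" "bipower_relation s1 s2 d1 d2 I c x y" "x0 \<noteq> 0" "\<And>i. i \<in> I \<Longrightarrow> x i = x0"
  shows "power_relation s2 d2 I c y"
  unfolding power_relation_def
proof
  interpret vector_space s1 by fact
  fix gs assume gs: "gs \<in> dual_lists s2 d2"
  obtain fs where fs: "fs \<in> dual_lists s1 d1" "(\<Prod>f\<leftarrow>fs. f x0) = 1"
    by (rule killing_list[of "{}" d1 x0]) (use assms(3) in auto)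
  have "(\<Sum>i\<in>I. c i * (\<Prod>g\<leftarrow>gs. g (y i))) =
      (\<Sum>i\<in>I. c i * ((\<Prod>f\<leftarrow>fs. f (x i)) * (\<Prod>g\<leftarrow>gs. g (y i))))"
    using assms(4) fs(2) by (intro sum.cong) auto
  also have "\<dots> = 0" using assms(2) fs(1) gs unfolding bipower_relation_def by blast
  finally show "(\<Sum>i\<in>I. c i * (\<Prod>g\<leftarrow>gs. g (y i))) = 0" .
qed

lemma exists_intermediate_set:
  assumes "finite M" "L \<subseteq> M" "card L \<le> k"
  obtains B where "L \<subseteq> B" "B \<subseteq> M" "card B = min k (card M)"
proof -
  have "card L \<le> min k (card M)" using assms by (simp add: card_mono)
  then show ?thesis using exists_subset_between[of L "min k (card M)" M] assms(1,2) that by auto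
qed

text \<open>If both fibres through \<open>z0\<close> were small, a product of \<open>d1\<close>
  linear forms on the first factor and \<open>d2\<close> on the second would vanish on
  \<open>W\<close> except at \<open>z0\<close>, and the relation would become
  \<open>c z0 = 0\<close>.\<close>

lemma bipower_relation_large_fibre:
  assumes V: "vector_space s1" "vector_space s2"
    and W: "finite W" "W \<subseteq> proj_space s1 \<times> proj_space s2" "card W \<le> d1 + d2 + 1"
    and c: "\<And>z. z \<in> W \<Longrightarrow> c z \<noteq> 0"
    and rel: "bipower_relation s1 s2 d1 d2 W c (\<lambda>z. representative s1 (fst z)) (\<lambda>z. representative s2 (snd z))"
    and z0: "z0 \<in> W"
  shows "d2 + 2 \<le> card {z \<in> W. fst z = fst z0} \<or> d1 + 2 \<le> card {z \<in> W. snd z = snd z0}"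
proof (rule ccontr)
  assume small: "\<not> ?thesis"
  interpret V1: vector_space s1 by fact
  interpret V2: vector_space s2 by fact
  let ?x = "\<lambda>z. representative s1 (fst z)" and ?y = "\<lambda>z. representative s2 (snd z)"
  define Z where "Z = W - {z0}"
  have Z: "finite Z" "card Z \<le> d1 + d2" using W z0 by (auto simp: Z_def)
  let ?L = "{z \<in> Z. fst z = fst z0}" and ?M = "{z \<in> Z. snd z \<noteq> snd z0}"
  have "{z \<in> W. fst z = fst z0} = insert z0 ?L" "{z \<in> W. snd z = snd z0} = insert z0 (Z - ?M)"
    using z0 by (auto simp: Z_def)
  moreover have "z0 \<notin> ?L" "z0 \<notin> Z - ?M" by (auto simp: Z_def)
  ultimately have LM: "card ?L \<le> d2" "card (Z - ?M) \<le> d1"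
    using small Z(1) by (auto simp: card_insert_disjoint)
  \<comment> \<open>Each point of \<open>B\<close> is killed by a linear form on the second factor, each point of \<open>Z - B\<close> by
    one on the first.\<close>
  have "?L \<subseteq> ?M" by (auto simp: Z_def prod_eq_iff)
  with LM(1) Z(1) obtain B where B: "?L \<subseteq> B" "B \<subseteq> ?M" "card B = min d2 (card ?M)"
    by (rule_tac exists_intermediate_set[of ?M ?L d2]) auto
  have "B \<subseteq> Z" using B(2) by auto
  then have "card (Z - B) = card Z - card B" "card (Z - ?M) = card Z - card ?M"
    using Z(1) finite_subset[OF _ Z(1)] by (auto intro!: card_Diff_subset)
  \<comment> \<open>If \<open>B\<close> has \<open>d2\<close> elements, the bound
    \<open>d1 + d2\<close> on \<open>Z\<close> leaves at most \<open>d1\<close> points; otherwise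
    \<open>B = ?M\<close>, and what is left is the fibre of \<open>snd z0\<close> without
    \<open>z0\<close>.\<close>
  then have ZB: "card (Z - B) \<le> d1" using LM(2) Z(2) B(3) by (auto simp: min_def split: if_splits)
  have dp1: "distinct_points s1 (proj_space s1) (representative s1)"
    and dp2: "distinct_points s2 (proj_space s2) (representative s2)"
    using V1.distinct_points_representative V2.distinct_points_representative by auto
  have in_proj: "fst z \<in> proj_space s1" "snd z \<in> proj_space s2" if "z \<in> W" for z using that W(2) by auto
  have ne1: "?x z0 \<notin> V1.span {?x z}" if "z \<in> Z - B" for z
  proof -
    have "z \<in> W" "fst z0 \<noteq> fst z" using that B(1) by (auto simp: Z_def)
    then show ?thesis using dp1 in_proj(1) z0 unfolding distinct_points_def by blast
  qed
  have ne2: "?y z0 \<notin> V2.span {?y z}" if "z \<in> B" for z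
  proof -
    have "z \<in> W" "snd z0 \<noteq> snd z" using that B(2) by (auto simp: Z_def)
    then show ?thesis using dp2 in_proj(2) z0 unfolding distinct_points_def by blast
  qed
  obtain fs where fs: "fs \<in> dual_lists s1 d1" "(\<Prod>f\<leftarrow>fs. f (?x z0)) = 1"
    "\<And>z. z \<in> Z - B \<Longrightarrow> (\<Prod>f\<leftarrow>fs. f (?x z)) = 0"
    by (rule V1.killing_list[of "Z - B" d1 "?x z0" ?x])
      (use Z(1) ZB ne1 dp1 in_proj z0 in \<open>auto simp: distinct_points_def\<close>)
  obtain gs where gs: "gs \<in> dual_lists s2 d2" "(\<Prod>g\<leftarrow>gs. g (?y z0)) = 1"
    "\<And>z. z \<in> B \<Longrightarrow> (\<Prod>g\<leftarrow>gs. g (?y z)) = 0"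
    by (rule V2.killing_list[of B d2 "?y z0" ?y])
      (use finite_subset[OF \<open>B \<subseteq> Z\<close> Z(1)] B(3) ne2 dp2 in_proj z0 in \<open>auto simp: distinct_points_def\<close>)
  have "(\<Sum>z\<in>W. c z * ((\<Prod>f\<leftarrow>fs. f (?x z)) * (\<Prod>g\<leftarrow>gs. g (?y z)))) =
      c z0 + (\<Sum>z\<in>Z. c z * ((\<Prod>f\<leftarrow>fs. f (?x z)) * (\<Prod>g\<leftarrow>gs. g (?y z))))"
    unfolding Z_def using fs(2) gs(2) by (simp add: sum.remove[OF W(1) z0])
  also have "(\<Sum>z\<in>Z. c z * ((\<Prod>f\<leftarrow>fs. f (?x z)) * (\<Prod>g\<leftarrow>gs. g (?y z)))) = 0"
  proof (rule sum.neutral, rule ballI)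
    fix z assume "z \<in> Z"
    then show "c z * ((\<Prod>f\<leftarrow>fs. f (?x z)) * (\<Prod>g\<leftarrow>gs. g (?y z))) = 0"
      using fs(3)[of z] gs(3)[of z] by (cases "z \<in> B") simp_all
  qed
  finally show False using rel fs(1) gs(1) c[OF z0] unfolding bipower_relation_def by simp
qed

lemma min_decomps_difference:
  assumes "vector_space s1" "vector_space s2" "p \<noteq> 0"
    and S: "S \<in> min_decomps s1 s2 d1 d2 p" and A: "A \<in> min_decomps s1 s2 d1 d2 p"
  obtains W c where "S - A \<subseteq> W" "A - S \<subseteq> W" "W \<subseteq> S \<union> A" "\<And>z. z \<in> W \<Longrightarrow> c z \<noteq> 0"
    "bipower_relation s1 s2 d1 d2 W c (\<lambda>z. representative s1 (fst z)) (\<lambda>z. representative s2 (snd z))"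
proof -
  let ?x = "\<lambda>z. representative s1 (fst z)" and ?y = "\<lambda>z. representative s2 (snd z)"
  have fin: "finite S" "finite A" and cards: "card S = tensor_rank s1 s2 d1 d2 p" "card A = tensor_rank s1 s2 d1 d2 p"
    using S A min_decomps_iff[OF assms(1-3)] by blast+
  obtain a where a: "p = decomp_sum s1 s2 d1 d2 S a" using S min_decomps_iff[OF assms(1-3)] by blast
  obtain b where b: "p = decomp_sum s1 s2 d1 d2 A b" using A min_decomps_iff[OF assms(1-3)] by blast
  \<comment> \<open>Coefficients extended by 0. On \<open>S - A\<close> and \<open>A - S\<close>
    they are nonzero by minimality, while at common points of \<open>S\<close> and \<open>A\<close>
    they may cancel; such points are left out of \<open>W\<close>.\<close>
  define c where "c z = (if z \<in> S then a z else 0) - (if z \<in> A then b z else 0)" for z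
  define W where "W = {z \<in> S \<union> A. c z \<noteq> 0}"
  have "a z \<noteq> 0" if "z \<in> S" for z using minimal_coeff_nonzero[OF fin(1) cards(1) a that] .
  moreover have "b z \<noteq> 0" if "z \<in> A" for z using minimal_coeff_nonzero[OF fin(2) cards(2) b that] .
  ultimately have "S - A \<subseteq> W" "A - S \<subseteq> W" by (auto simp: W_def c_def)
  moreover have "bipower_relation s1 s2 d1 d2 W c ?x ?y"
    unfolding bipower_relation_def
  proof (intro ballI)
    fix fs gs assume fg: "fs \<in> dual_lists s1 d1" "gs \<in> dual_lists s2 d2"
    let ?t = "\<lambda>z. (\<Prod>f\<leftarrow>fs. f (?x z)) * (\<Prod>g\<leftarrow>gs. g (?y z))"
    have "(\<Sum>z\<in>S. a z * ?t z) = p fs gs" "(\<Sum>z\<in>A. b z * ?t z) = p fs gs"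
      using fg by (simp add: a tensor_sum_def tensor_power_def)
        (use fg in \<open>simp add: b tensor_sum_def tensor_power_def\<close>)
    moreover have "(\<Sum>z\<in>S. a z * ?t z) = (\<Sum>z\<in>S \<union> A. (if z \<in> S then a z else 0) * ?t z)"
      using fin by (intro sum.mono_neutral_cong_left) auto
    moreover have "(\<Sum>z\<in>A. b z * ?t z) = (\<Sum>z\<in>S \<union> A. (if z \<in> A then b z else 0) * ?t z)"
      using fin by (intro sum.mono_neutral_cong_left) auto
    ultimately have "(\<Sum>z\<in>S \<union> A. c z * ?t z) = 0"
      unfolding c_def left_diff_distrib sum_subtractf by simp
    moreover have "(\<Sum>z\<in>S \<union> A. c z * ?t z) = (\<Sum>z\<in>W. c z * ?t z)"
      using fin by (intro sum.mono_neutral_right) (auto simp: W_def)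
    ultimately show "(\<Sum>z\<in>W. c z * ?t z) = 0" by simp
  qed
  moreover have "W \<subseteq> S \<union> A" "\<And>z. z \<in> W \<Longrightarrow> c z \<noteq> 0" by (auto simp: W_def)
  ultimately show ?thesis using that by blast
qed

section \<open>The line of a pair of decompositions\<close>

text \<open>
  What the hypotheses (a) or (b) say about the decompositions, in a form that is symmetric in the two
  factors.
\<close>

definition small_decomp :: "nat \<Rightarrow> nat \<Rightarrow> ('a \<times> 'b) set \<Rightarrow> bool" where
  "small_decomp d1 d2 S \<longleftrightarrow> 2 * card S \<le> d1 + d2 + 1 \<and> card S \<le> d1 + 1 \<and> card S \<le> d2 + 1 \<and>
    (\<forall>P. S \<subseteq> {P} \<times> UNIV \<longrightarrow> card S \<le> d2) \<and> (\<forall>Q. S \<subseteq> UNIV \<times> {Q} \<longrightarrow> card S \<le> d1)"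

lemma small_decomp_swap: "small_decomp d1 d2 S \<Longrightarrow> small_decomp d2 d1 (prod.swap ` S)"
proof -
  have "prod.swap ` S \<subseteq> {Q} \<times> UNIV \<longleftrightarrow> S \<subseteq> UNIV \<times> {Q}" "prod.swap ` S \<subseteq> UNIV \<times> {P} \<longleftrightarrow> S \<subseteq> {P} \<times> UNIV" for P Q
    by force+
  then show "small_decomp d1 d2 S \<Longrightarrow> small_decomp d2 d1 (prod.swap ` S)"
    unfolding small_decomp_def by (simp add: card_image add.commute)
qed

text \<open>In terms of \<open>b = d + 2 - card (S \<inter> T)\<close>, the two cardinality
  conditions read \<open>2 * b \<le> d + 2\<close> and \<open>2 \<le> b\<close>. This form serves
  cases (i) and (ii) alike, with \<open>d = d2\<close> and \<open>d = d1\<close>.\<close>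

definition splits_along :: "nat \<Rightarrow> 'a set \<Rightarrow> 'a set \<Rightarrow> 'a set \<Rightarrow> bool" where
  "splits_along d T S A \<longleftrightarrow> S - T = A - T \<and> d + 2 \<le> 2 * card (S \<inter> T) \<and> card (S \<inter> T) \<le> d"

lemma card_Int_eq_of_Diff_eq:
  assumes "finite S" "finite A" "card S = card A" "S - T = A - T"
  shows "card (S \<inter> T) = card (A \<inter> T)"
proof -
  have "card S = card (S - T) + card (S \<inter> T)" "card A = card (A - T) + card (A \<inter> T)"
    using assms(1,2) by (metis add.commute card_Int_Diff)+
  then show ?thesis using assms(3,4) by simp
qed

lemma splits_along_sym:
  assumes "finite S" "finite A" "card S = card A" "splits_along d T S A"
  shows "splits_along d T A S"
proof -
  have diff: "S - T = A - T" using assms(4) unfolding splits_along_def by blast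
  show ?thesis
    using assms(4) diff unfolding splits_along_def card_Int_eq_of_Diff_eq[OF assms(1-3) diff] by simp
qed

lemma card_Int_add:
  assumes "finite S"
  shows "card (S \<inter> T) + card (S \<inter> T') = card (S \<inter> (T \<union> T')) + card (S \<inter> (T \<inter> T'))"
proof -
  have "S \<inter> T \<union> S \<inter> T' = S \<inter> (T \<union> T')" "S \<inter> T \<inter> (S \<inter> T') = S \<inter> (T \<inter> T')" by blast+
  then show ?thesis using card_Un_Int[of "S \<inter> T" "S \<inter> T'"] assms by simp
qed

lemma min_decompsD:
  assumes "S \<in> min_decomps s1 s2 d1 d2 p"
  shows "finite S" "S \<subseteq> proj_space s1 \<times> proj_space s2" "card S = tensor_rank s1 s2 d1 d2 p"
  using assms unfolding min_decomps_def by auto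

text \<open>In one fibre the relation becomes a power relation of degree \<open>d2\<close> in the
  second factor. Its points are collinear if there are at most \<open>2 * d2 + 1\<close> of them,
  and there are at least \<open>d2 + 2\<close>. The upper bound on
  \<open>card (S \<inter> T)\<close> comes from the rank of binary forms.\<close>

lemma beta_line_of_fibre:
  fixes s1 :: "'k::field_char_0 \<Rightarrow> 'v::ab_group_add \<Rightarrow> 'v" and s2 :: "'k \<Rightarrow> 'w::ab_group_add \<Rightarrow> 'w"
  assumes V: "vector_space s1" "vector_space s2" and "p \<noteq> 0" "d2 \<ge> 1"
    and S: "S \<in> min_decomps s1 s2 d1 d2 p" and A: "A \<in> min_decomps s1 s2 d1 d2 p"
    and small: "small_decomp d1 d2 S"
    and W: "S - A \<subseteq> W" "A - S \<subseteq> W" "W \<subseteq> S \<union> A" "W \<noteq> {}" and c: "\<And>z. z \<in> W \<Longrightarrow> c z \<noteq> 0"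
    and rel: "bipower_relation s1 s2 d1 d2 W c (\<lambda>z. representative s1 (fst z)) (\<lambda>z. representative s2 (snd z))"
    and fibre: "\<And>z. z \<in> W \<Longrightarrow> fst z = P"
  shows "\<exists>T. beta_line s1 s2 T \<and> splits_along d2 T S A"
proof -
  interpret V2: vector_space s2 by fact
  have SA: "finite S" "finite A" "S \<subseteq> proj_space s1 \<times> proj_space s2" "A \<subseteq> proj_space s1 \<times> proj_space s2"
    "card S = tensor_rank s1 s2 d1 d2 p" "card S = card A"
    using min_decompsD[OF S] min_decompsD[OF A] by simp_all
  have finW: "finite W" using W(3) SA(1,2) finite_subset by blast
  have projW: "fst z \<in> proj_space s1" "snd z \<in> proj_space s2" if "z \<in> W" for z
  proof -
    have "z \<in> proj_space s1 \<times> proj_space s2" using that W(3) SA(3,4) by blast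
    then show "fst z \<in> proj_space s1" "snd z \<in> proj_space s2" by (simp_all add: mem_Times_iff)
  qed
  have P: "P \<in> proj_space s1" using W(4) projW(1) fibre by blast
  have power: "power_relation s2 d2 W c (\<lambda>z. representative s2 (snd z))"
    using bipower_relation_fibre[OF V(1) rel representative(1)[OF P]] fibre by auto
  have distinct: "distinct_points s2 W (\<lambda>z. representative s2 (snd z))"
    unfolding distinct_points_def
  proof (intro ballI conjI impI)
    fix z z' assume zz: "z \<in> W" "z' \<in> W" "z \<noteq> z'"
    then have "snd z \<noteq> snd z'" using fibre by (metis prod_eqI)
    then show "representative s2 (snd z) \<notin> V2.span {representative s2 (snd z')}"
      using V2.distinct_points_representative[OF order_refl] projW zz unfolding distinct_points_def by blast
  qed (rule representative(1)[OF projW(2)])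
  \<comment> \<open>If \<open>S\<close> is not in the fibre, then a common point of \<open>S\<close> and \<open>A\<close> outside of it improves the bound
    on \<open>W\<close> from \<open>2 * d2 + 2\<close> to \<open>2 * d2\<close>.\<close>
  define F where "F = {P} \<times> (UNIV :: 'w set set)"
  have WF: "W \<subseteq> F" using fibre by (auto simp: F_def)
  have "S - F = A - F" using W(1,2) WF by blast
  then have "card (S \<inter> F) = card (A \<inter> F)" by (rule card_Int_eq_of_Diff_eq[OF SA(1,2,6)])
  moreover have "card W \<le> card ((S \<inter> F) \<union> (A \<inter> F))" using W(3) WF SA(1,2) by (intro card_mono) auto
  moreover have "card ((S \<inter> F) \<union> (A \<inter> F)) \<le> card (S \<inter> F) + card (A \<inter> F)" by (rule card_Un_le)
  moreover have "card (S \<inter> F) \<le> d2"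
  proof (cases "S \<subseteq> F")
    case True
    then show ?thesis using small unfolding small_decomp_def F_def by (metis Int_absorb2)
  next
    case False
    then have "card (S \<inter> F) < card S" using SA(1) by (intro psubset_card_mono) auto
    then show ?thesis using small unfolding small_decomp_def by linarith
  qed
  ultimately have cardW: "card W \<le> 2 * d2 + 1" by linarith
  obtain u v where uv: "(\<lambda>z. representative s2 (snd z)) ` W \<subseteq> V2.span {u, v}"
    using V2.power_relation_collinear[OF finW distinct c power cardW] by blast
  have large: "d2 + 2 \<le> card W" by (rule V2.power_relation_card[OF finW W(4) distinct c power])
  obtain z z' where zz: "z \<in> W" "z' \<in> W" "z \<noteq> z'"
  proof -
    have "\<not> card W \<le> 1" using large by simp
    then show ?thesis using that card_le_Suc0_iff_eq[OF finW] by auto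
  qed
  then have ne: "snd z \<noteq> snd z'" using fibre by (metis prod_eqI)
  define L where "L = {Q \<in> proj_space s2. Q \<subseteq> V2.span {u, v}}"
  have snd_W: "snd ` W \<subseteq> proj_space s2" "representative s2 ` snd ` W \<subseteq> V2.span {u, v}"
    using projW(2) uv by (auto simp: image_image)
  note L = V2.collinear_points[OF snd_W(1) imageI[OF zz(1)] imageI[OF zz(2)] ne snd_W(2), folded L_def]
  define T where "T = {P} \<times> L"
  have WT: "W \<subseteq> T" using L(2) fibre by (auto simp: T_def)
  have diff: "S - T = A - T" using W(1,2) WT by blast
  \<comment> \<open>The points of \<open>W\<close> come from \<open>S \<inter> T\<close> and
    \<open>A \<inter> T\<close>, which have equal size because \<open>S\<close> and \<open>A\<close>
    agree outside \<open>T\<close>; so \<open>S \<inter> T\<close> has at least half as many points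
    as \<open>W\<close>.\<close>
  have "card W \<le> card ((S \<inter> T) \<union> (A \<inter> T))" using W(3) WT SA(1,2) by (intro card_mono) auto
  also have "\<dots> \<le> card (S \<inter> T) + card (A \<inter> T)" by (rule card_Un_le)
  also have "\<dots> = 2 * card (S \<inter> T)" using card_Int_eq_of_Diff_eq[OF SA(1,2,6) diff] by simp
  finally have "d2 + 2 \<le> 2 * card (S \<inter> T)" using large by simp
  moreover have "card (S \<inter> T) \<le> d2"
  proof -
    obtain a where a: "p = decomp_sum s1 s2 d1 d2 S a" using S min_decomps_iff[OF V \<open>p \<noteq> 0\<close>] by blast
    show ?thesis
    proof (rule minimal_fibre_card[OF V(2) SA(1,5) a])
      show "(\<lambda>z. representative s2 (snd z)) ` (S \<inter> T) \<subseteq> V2.span {u, v}"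
        using V2.subset_iff_representative[OF _ V2.subspace_span] by (auto simp: T_def L_def)
    qed (use assms(4) in \<open>auto simp: T_def\<close>)
  qed
  ultimately have "splits_along d2 T S A" using diff by (simp add: splits_along_def)
  moreover have "beta_line s1 s2 T" using P L(1) by (auto simp: beta_line_def T_def)
  ultimately show ?thesis by blast
qed

section \<open>Existence of the line, with \<alpha>-lines reduced to \<beta>-lines\<close>

lemma beta_line_swap: "beta_line s2 s1 (prod.swap ` T) \<longleftrightarrow> alpha_line s1 s2 T"
proof -
  have "prod.swap ` T = {Q} \<times> R \<longleftrightarrow> T = R \<times> {Q}" for Q R
    by (subst product_swap[symmetric]) (rule inj_image_eq_iff[OF inj_swap])
  then show ?thesis unfolding beta_line_def alpha_line_def by metis
qed

lemma splits_along_swap: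
  "splits_along d (prod.swap ` T) (prod.swap ` S) (prod.swap ` A) \<longleftrightarrow> splits_along d T S A"
proof -
  have i: "inj prod.swap" by (rule inj_swap)
  show ?thesis unfolding splits_along_def
    by (simp add: image_set_diff[OF i, symmetric] image_Int[OF i, symmetric] card_image inj_image_eq_iff[OF i])
qed

text \<open>Every point of \<open>W\<close> lies in a large fibre of one of the two projections, and
  \<open>W\<close> has room for one large fibre only. So \<open>W\<close> is contained in a
  fibre.\<close>

lemma line_exists:
  fixes s1 :: "'k::field_char_0 \<Rightarrow> 'v::ab_group_add \<Rightarrow> 'v" and s2 :: "'k \<Rightarrow> 'w::ab_group_add \<Rightarrow> 'w"
  assumes V: "vector_space s1" "vector_space s2" and "p \<noteq> 0" "d1 \<ge> 1" "d2 \<ge> 1"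
    and S: "S \<in> min_decomps s1 s2 d1 d2 p" and A: "A \<in> min_decomps s1 s2 d1 d2 p" and "S \<noteq> A"
    and small: "small_decomp d1 d2 S"
  shows "\<exists>T. beta_line s1 s2 T \<and> splits_along d2 T S A \<or> alpha_line s1 s2 T \<and> splits_along d1 T S A"
proof -
  obtain W c where W: "S - A \<subseteq> W" "A - S \<subseteq> W" "W \<subseteq> S \<union> A" and c: "\<And>z. z \<in> W \<Longrightarrow> c z \<noteq> 0"
    and rel: "bipower_relation s1 s2 d1 d2 W c (\<lambda>z. representative s1 (fst z)) (\<lambda>z. representative s2 (snd z))"
    by (rule min_decomps_difference[OF V \<open>p \<noteq> 0\<close> S A]) (rule that)
  have SA: "finite S" "finite A" "S \<subseteq> proj_space s1 \<times> proj_space s2" "A \<subseteq> proj_space s1 \<times> proj_space s2"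
    "card S = card A"
    using min_decompsD[OF S] min_decompsD[OF A] by simp_all
  have finW: "finite W" using W(3) SA(1,2) finite_subset by blast
  have W_ne: "W \<noteq> {}" using W(1,2) \<open>S \<noteq> A\<close> by blast
  have "card W \<le> card S + card A"
    using card_mono[OF _ W(3)] card_Un_le[of S A] SA(1,2) by (meson finite_UnI le_trans)
  then have cardW: "card W \<le> d1 + d2 + 1" "card W \<le> 2 * d1 + 2" "card W \<le> 2 * d2 + 2"
    using small SA(5) unfolding small_decomp_def by linarith+
  let ?F = "\<lambda>z0. {z \<in> W. fst z = fst z0}" and ?G = "\<lambda>z0. {z \<in> W. snd z = snd z0}"
  have large: "d2 + 2 \<le> card (?F z0) \<or> d1 + 2 \<le> card (?G z0)" if "z0 \<in> W" for z0
    using bipower_relation_large_fibre[OF V finW _ cardW(1) c rel that] W(3) SA(3,4) by blast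
  have union: "card B + card C \<le> card W + card (B \<inter> C)" if "B \<subseteq> W" "C \<subseteq> W" for B C
  proof -
    have "finite B" "finite C" using that finW finite_subset by auto
    then have "card B + card C = card (B \<union> C) + card (B \<inter> C)" by (rule card_Un_Int)
    then show ?thesis using card_mono[of W "B \<union> C"] that finW by simp
  qed
  \<comment> \<open>Fibres of the two different projections share at most one point, so together
    they would have at least \<open>d1 + d2 + 3\<close> points.\<close>
  have not_both: False if "z \<in> W" "z' \<in> W" "d2 + 2 \<le> card (?F z)" "d1 + 2 \<le> card (?G z')" for z z'
  proof -
    have "?F z \<inter> ?G z' \<subseteq> {(fst z, snd z')}" by auto
    then have "card (?F z \<inter> ?G z') \<le> 1" using card_mono[of "{(fst z, snd z')}"] by fastforce
    then show False using union[of "?F z" "?G z'"] that cardW(1) by auto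
  qed
  show ?thesis
  proof (cases "\<exists>z0\<in>W. d2 + 2 \<le> card (?F z0)")
    case True
    then obtain z0 where z0: "z0 \<in> W" "d2 + 2 \<le> card (?F z0)" by blast
    \<comment> \<open>Two disjoint fibres would have at least \<open>2 * d2 + 4\<close> points, but
      \<open>W\<close> has at most \<open>2 * d2 + 2\<close>.\<close>
    have "fst z = fst z0" if "z \<in> W" for z
    proof (rule ccontr)
      assume "fst z \<noteq> fst z0"
      then have "?F z \<inter> ?F z0 = {}" by auto
      moreover have "d2 + 2 \<le> card (?F z)" using large[OF that] not_both[OF z0(1) that z0(2)] by blast
      ultimately show False using union[of "?F z" "?F z0"] z0(2) cardW(3) by auto
    qed
    from beta_line_of_fibre[OF V \<open>p \<noteq> 0\<close> \<open>d2 \<ge> 1\<close> S A small W W_ne c rel this]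
    show ?thesis by blast
  next
    case False
    then have G: "d1 + 2 \<le> card (?G z)" if "z \<in> W" for z using large that by blast
    obtain z0 where z0: "z0 \<in> W" using W_ne by blast
    have snd_eq: "snd z = snd z0" if "z \<in> W" for z
    proof (rule ccontr)
      assume "snd z \<noteq> snd z0"
      then have "?G z \<inter> ?G z0 = {}" by auto
      then show False using union[of "?G z" "?G z0"] G[OF that] G[OF z0] cardW(2) by auto
    qed
    let ?s = "\<lambda>X. prod.swap ` X"
    have "bipower_relation s2 s1 d2 d1 (?s W) (c \<circ> prod.swap)
        (\<lambda>z. representative s2 (fst z)) (\<lambda>z. representative s1 (snd z))"
      using bipower_relation_swap[OF rel] unfolding bipower_relation_def
      by (simp add: sum.reindex)
    moreover have "?s S - ?s A \<subseteq> ?s W" "?s A - ?s S \<subseteq> ?s W" "?s W \<subseteq> ?s S \<union> ?s A" "?s W \<noteq> {}"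
      using W W_ne by (auto simp: image_set_diff[OF inj_swap, symmetric] image_Un[symmetric] simp del: image_Un)
    moreover have "swap_tensor p \<noteq> 0" using \<open>p \<noteq> 0\<close> by (auto simp: swap_tensor_def fun_eq_iff)
    ultimately have "\<exists>T. beta_line s2 s1 T \<and> splits_along d1 T (?s S) (?s A)"
      using snd_eq c
      by (intro beta_line_of_fibre[OF V(2,1) _ \<open>d1 \<ge> 1\<close> swap_min_decomps[OF V \<open>p \<noteq> 0\<close> S]
          swap_min_decomps[OF V \<open>p \<noteq> 0\<close> A] small_decomp_swap[OF small], where W = "?s W" and P = "snd z0"
          and c = "c \<circ> prod.swap"]) auto
    \<comment> \<open>The line is written as a double exchange, so that both swap lemmas apply with
      \<open>?s T\<close> as the line in the original factors.\<close>
    then obtain T where T: "beta_line s2 s1 (?s (?s T))" "splits_along d1 (?s (?s T)) (?s S) (?s A)"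
      by (auto simp: image_image)
    have "alpha_line s1 s2 (?s T)" "splits_along d1 (?s T) S A"
      using T unfolding beta_line_swap splits_along_swap .
    then show ?thesis by blast
  qed
qed

text \<open>Two disjoint lines would contain \<open>d2 + 2\<close> points of \<open>S\<close>, which
  has at most \<open>d2 + 1\<close>. Two lines in the same fibre share at most one point and hence
  contain at least \<open>d2 + 1\<close> points, that is all of \<open>S\<close>; but inside a fibre
  \<open>S\<close> has at most \<open>d2\<close>.\<close>

lemma beta_line_unique:
  assumes "vector_space s2" "finite S" "small_decomp d1 d2 S" "beta_line s1 s2 T" "beta_line s1 s2 T'"
    and large: "d2 + 2 \<le> 2 * card (S \<inter> T)" "d2 + 2 \<le> 2 * card (S \<inter> T')"
  shows "T = T'"
proof (rule ccontr)
  assume ne: "T \<noteq> T'"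
  obtain P L P' L' where T: "T = {P} \<times> L" "proj_line s2 L" and T': "T' = {P'} \<times> L'" "proj_line s2 L'"
    using assms(4,5) unfolding beta_line_def by blast
  have sum: "card (S \<inter> T) + card (S \<inter> T') = card (S \<inter> (T \<union> T')) + card (S \<inter> (T \<inter> T'))" by (rule card_Int_add[OF assms(2)])
  have sub: "card (S \<inter> (T \<union> T')) \<le> card S" using assms(2) by (intro card_mono) auto
  show False
  proof (cases "P = P'")
    case False
    then have "T \<inter> T' = {}" using T T' by auto
    then show False using sum sub large assms(3) unfolding small_decomp_def by simp
  next
    case True
    have "x = y" if "x \<in> T \<inter> T'" "y \<in> T \<inter> T'" for x y
    proof (rule ccontr)
      assume "x \<noteq> y"
      moreover have "fst x = fst y" "{snd x, snd y} \<subseteq> L \<inter> L'"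
        using that T(1) T'(1) by (auto simp: mem_Times_iff)
      ultimately have "L = L'"
        by (intro proj_line_unique[OF assms(1) T(2) T'(2)]) (auto simp: prod_eq_iff)
      then show False using ne T(1) T'(1) True by simp
    qed
    then have "card (S \<inter> (T \<inter> T')) \<le> 1"
      using assms(2) by (simp add: card_le_Suc0_iff_eq)
    then have "d2 + 1 \<le> card (S \<inter> (T \<union> T'))" using sum large by linarith
    moreover have "S \<inter> (T \<union> T') = S"
      using calculation sub assms(2,3) unfolding small_decomp_def by (intro card_subset_eq) auto
    then have "S \<subseteq> {P} \<times> UNIV" using T(1) T'(1) True by auto
    ultimately show False using sub assms(3) unfolding small_decomp_def by fastforce
  qed
qed

lemma alpha_line_unique:
  assumes "vector_space s1" "finite S" "small_decomp d1 d2 S" "alpha_line s1 s2 T" "alpha_line s1 s2 T'"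
    and large: "d1 + 2 \<le> 2 * card (S \<inter> T)" "d1 + 2 \<le> 2 * card (S \<inter> T')"
  shows "T = T'"
proof -
  have "prod.swap ` T = prod.swap ` T'"
    using assms beta_line_unique[OF assms(1) finite_imageI[OF assms(2)] small_decomp_swap[OF assms(3)], of s2]
    by (simp add: beta_line_swap image_Int[OF inj_swap, symmetric] card_image)
  then show ?thesis by (simp add: inj_image_eq_iff[OF inj_swap])
qed

lemma alpha_beta_line_Int:
  assumes "alpha_line s1 s2 T" "beta_line s1 s2 T'"
  shows "\<exists>z. T \<inter> T' \<subseteq> {z}"
  using assms unfolding alpha_line_def beta_line_def by blast

text \<open>Such lines meet in at most one point, so twice the size of \<open>S\<close> would be at
  least \<open>d1 + d2 + 2\<close>, against the bound \<open>d1 + d2 + 1\<close>.\<close>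

lemma not_alpha_and_beta_line:
  assumes "finite S" "small_decomp d1 d2 S" "alpha_line s1 s2 T" "beta_line s1 s2 T'"
    and large: "d1 + 2 \<le> 2 * card (S \<inter> T)" "d2 + 2 \<le> 2 * card (S \<inter> T')"
  shows False
proof -
  obtain z where "T \<inter> T' \<subseteq> {z}" using alpha_beta_line_Int[OF assms(3,4)] by blast
  then have "S \<inter> (T \<inter> T') \<subseteq> {z}" by blast
  then have "card (S \<inter> (T \<inter> T')) \<le> 1" using card_mono[of "{z}"] by fastforce
  moreover have "card (S \<inter> T) + card (S \<inter> T') = card (S \<inter> (T \<union> T')) + card (S \<inter> (T \<inter> T'))" by (rule card_Int_add[OF assms(1)])
  moreover have "card (S \<inter> (T \<union> T')) \<le> card S" using assms(1) by (intro card_mono) auto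
  ultimately show False using large assms(2) unfolding small_decomp_def by linarith
qed

section \<open>Independence of the pair\<close>

text \<open>The set equations force \<open>E = S - T\<close>, so the formula for
  \<open>card E\<close> determines \<open>b\<close>. Then \<open>r \<ge> d + 2 - b\<close> says
  \<open>card (S \<inter> T) \<le> r\<close>, and the bounds on \<open>b\<close> are those of
  \<open>splits_along\<close>.\<close>

lemma splits_along_iff:
  assumes "finite S" "finite A" "card S = r" "card A = r"
  shows "2 \<le> b \<and> 2 * b \<le> int d + 2 \<and> int r \<ge> int d + 2 - b \<and> finite E \<and>
      int (card E) = int r + b - int d - 2 \<and> E \<inter> T = {} \<and> S = E \<union> (S \<inter> T) \<and> A = E \<union> (A \<inter> T) \<longleftrightarrow>
    splits_along d T S A \<and> E = S - T \<and> b = int d + 2 - int (card (S \<inter> T))" (is "?l \<longleftrightarrow> ?r")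
proof -
  have S: "card (S - T) + card (S \<inter> T) = r"
    using card_Int_Diff[OF assms(1), of T] assms(3) by simp
  show ?thesis
  proof
    assume l: ?l
    have "E = S - T" using l by blast
    moreover have "E = A - T" using l by blast
    ultimately show ?r using l S unfolding splits_along_def by auto
  next
    assume ?r
    then show ?l using S assms(1,2) unfolding splits_along_def by auto
  qed
qed

lemma case_i_iff:
  assumes "S \<in> min_decomps s1 s2 d1 d2 p" "A \<in> min_decomps s1 s2 d1 d2 p"
  shows "case_i s1 s2 d1 d2 p S A b T E \<longleftrightarrow>
    beta_line s1 s2 T \<and> splits_along d2 T S A \<and> E = S - T \<and> b = int d2 + 2 - int (card (S \<inter> T))"
  unfolding case_i_def
  using splits_along_iff[OF min_decompsD(1)[OF assms(1)] min_decompsD(1)[OF assms(2)]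
      min_decompsD(3)[OF assms(1)] min_decompsD(3)[OF assms(2)], of b d2 E T] min_decompsD(2)[OF assms(1)]
  by blast

lemma case_ii_iff:
  assumes "S \<in> min_decomps s1 s2 d1 d2 p" "A \<in> min_decomps s1 s2 d1 d2 p"
  shows "case_ii s1 s2 d1 d2 p S A b T E \<longleftrightarrow>
    alpha_line s1 s2 T \<and> splits_along d1 T S A \<and> E = S - T \<and> b = int d1 + 2 - int (card (S \<inter> T))"
proof -
  have b: "b \<le> (int d1 + 2) div 2 \<longleftrightarrow> 2 * b \<le> int d1 + 2" by linarith
  show ?thesis
    unfolding case_ii_def b
    using splits_along_iff[OF min_decompsD(1)[OF assms(1)] min_decompsD(1)[OF assms(2)]
        min_decompsD(3)[OF assms(1)] min_decompsD(3)[OF assms(2)], of b d1 E T] min_decompsD(2)[OF assms(1)]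
    by blast
qed

text \<open>Rescaling the coefficients of a sum preserves the rank. This is what makes the line and
  \<open>E\<close> depend on the point \<open>[p]\<close> only.\<close>

lemma min_decomps_proj_pt:
  fixes s1 :: "'k::field \<Rightarrow> 'v::ab_group_add \<Rightarrow> 'v" and s2 :: "'k \<Rightarrow> 'w::ab_group_add \<Rightarrow> 'w"
    and p p' :: "('v, 'w, 'k) tensor"
  assumes "proj_pt tensor_scale p' = proj_pt tensor_scale p"
  shows "min_decomps s1 s2 d1 d2 p' = min_decomps s1 s2 d1 d2 p"
proof -
  interpret T: vector_space tensor_scale by (rule vector_space_tensor_scale)
  have transfer: "\<exists>c v w. q' = tensor_sum s1 s2 d1 d2 {..<r} c v w"
    if ex: "\<exists>c v w. q = tensor_sum s1 s2 d1 d2 {..<r} c v w"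
      and pt: "proj_pt tensor_scale q' = proj_pt tensor_scale q"
    for r :: nat and q q' :: "('v, 'w, 'k) tensor"
  proof -
    obtain c v w where q: "q = tensor_sum s1 s2 d1 d2 {..<r} c v w" using ex by blast
    have "q' \<in> T.span {q}" using pt T.span_base[of q' "{q'}"] by (simp add: proj_pt_def)
    then obtain k where "q' = tensor_scale k q" by (auto simp: T.span_singleton)
    then have "q' = tensor_sum s1 s2 d1 d2 {..<r} (\<lambda>i. k * c i) v w"
      by (simp add: q tensor_sum_def tensor_scale_def sum_distrib_left mult.assoc)
    then show ?thesis by blast
  qed
  have "tensor_rank s1 s2 d1 d2 p' = tensor_rank s1 s2 d1 d2 p"
    unfolding tensor_rank_eq using transfer[OF _ assms] transfer[OF _ assms[symmetric]]
    by (intro arg_cong[of _ _ Least] ext iffI)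
  then show ?thesis unfolding min_decomps_def assms by simp
qed

section \<open>Size bounds from the hypotheses (a) and (b)\<close>

lemma proj_span_mono:
  assumes "vector_space s" "X \<subseteq> Y"
  shows "proj_span s X \<subseteq> proj_span s Y"
proof -
  interpret vector_space s by fact
  have "span (\<Union>X) \<subseteq> span (\<Union>Y)" using assms(2) by (intro span_mono) blast
  then show ?thesis unfolding proj_span_def by blast
qed

lemma depends_on_one_factorI:
  assumes S: "S \<in> min_decomps s1 s2 d1 d2 p" "S \<noteq> {}"
    and "S \<subseteq> {P} \<times> UNIV \<or> S \<subseteq> UNIV \<times> {Q}"
  shows "depends_on_one_factor s1 s2 d1 d2 p"
proof -
  have sub: "S \<subseteq> proj_space s1 \<times> proj_space s2" by (rule min_decompsD(2)[OF S(1)])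
  have "proj_pt tensor_scale p \<in> proj_span tensor_scale (segre_veronese s1 s2 d1 d2 ` S)"
    using S(1) unfolding min_decomps_def by blast
  then have *: "proj_pt tensor_scale p \<in> proj_span tensor_scale (segre_veronese s1 s2 d1 d2 ` Y)" if "S \<subseteq> Y" for Y
    using proj_span_mono[OF vector_space_tensor_scale image_mono[OF that]] by blast
  from assms(3) show ?thesis
  proof
    assume "S \<subseteq> {P} \<times> UNIV"
    then have "S \<subseteq> {P} \<times> proj_space s2" "P \<in> proj_space s1" using sub S(2) by auto
    then show ?thesis using *[of "{P} \<times> proj_space s2"] unfolding depends_on_one_factor_def by blast
  next
    assume "S \<subseteq> UNIV \<times> {Q}"
    then have "S \<subseteq> proj_space s1 \<times> {Q}" "Q \<in> proj_space s2" using sub S(2) by auto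
    then show ?thesis using *[of "proj_space s1 \<times> {Q}"] unfolding depends_on_one_factor_def by blast
  qed
qed

text \<open>Under (a) the degrees differ by at most 2, so the rank is at most
  \<open>min d1 d2 + 1\<close>. A nonempty \<open>S\<close> inside a fibre makes \<open>p\<close>
  depend on one factor; then (a) leaves only \<open>d1 = d2\<close>, where the rank is at most
  \<open>d1\<close>. Under (b) the rank is at most \<open>min d1 d2\<close>, which gives all the
  bounds.\<close>

lemma small_decompI:
  assumes S: "S \<in> min_decomps s1 s2 d1 d2 p"
    and ab: "(2 * tensor_rank s1 s2 d1 d2 p \<le> 1 + d1 + d2 \<and> \<bar>int d1 - int d2\<bar> \<le> 2) \<or>
      tensor_rank s1 s2 d1 d2 p \<le> min d1 d2"
    and not_one_factor: "\<not> ((2 * tensor_rank s1 s2 d1 d2 p \<le> 1 + d1 + d2 \<and> \<bar>int d1 - int d2\<bar> \<le> 2) \<and>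
      d1 \<noteq> d2 \<and> depends_on_one_factor s1 s2 d1 d2 p)"
  shows "small_decomp d1 d2 S"
proof -
  have card: "card S = tensor_rank s1 s2 d1 d2 p" by (rule min_decompsD(3)[OF S])
  have fibre: "card S \<le> min d1 d2" if "S \<subseteq> {P} \<times> UNIV \<or> S \<subseteq> UNIV \<times> {Q}" for P Q
  proof (cases "S = {}")
    case False
    with S have "depends_on_one_factor s1 s2 d1 d2 p" using that by (rule depends_on_one_factorI)
    then show ?thesis using ab not_one_factor unfolding card by auto
  qed simp
  have "2 * card S \<le> d1 + d2 + 1" "card S \<le> d1 + 1" "card S \<le> d2 + 1"
    using ab unfolding card by auto
  then show ?thesis using fibre unfolding small_decomp_def by (meson min.bounded_iff)
qed

theorem proposition1p6:
  fixes s1 :: "'k::{alg_closed_field, field_char_0} \<Rightarrow> 'v::ab_group_add \<Rightarrow> 'v"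
    and s2 :: "'k \<Rightarrow> 'w::ab_group_add \<Rightarrow> 'w"
    and n1 n2 d1 d2 :: nat
    and p :: "('v, 'w, 'k) tensor"
  assumes V1: "vector_space s1" "vector_space.dim s1 UNIV = n1 + 1"
    and V2: "vector_space s2" "vector_space.dim s2 UNIV = n2 + 1"
    and d: "d1 > 0" "d2 > 0"
    and p: "p \<in> sym_tensor_space s1 s2 d1 d2" "p \<noteq> 0"
    and ab: "(2 * tensor_rank s1 s2 d1 d2 p \<le> 1 + d1 + d2 \<and> \<bar>int d1 - int d2\<bar> \<le> 2) \<or>
      tensor_rank s1 s2 d1 d2 p \<le> min d1 d2"
    and two: "\<exists>S \<in> min_decomps s1 s2 d1 d2 p. \<exists>A \<in> min_decomps s1 s2 d1 d2 p. S \<noteq> A"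
    and not_one_factor: "\<not> ((2 * tensor_rank s1 s2 d1 d2 p \<le> 1 + d1 + d2 \<and> \<bar>int d1 - int d2\<bar> \<le> 2) \<and>
      d1 \<noteq> d2 \<and> depends_on_one_factor s1 s2 d1 d2 p)"
  shows
    "(\<forall>S \<in> min_decomps s1 s2 d1 d2 p. \<forall>A \<in> min_decomps s1 s2 d1 d2 p. S \<noteq> A \<longrightarrow>
        (\<exists>b T E. case_i s1 s2 d1 d2 p S A b T E) \<noteq> (\<exists>b T E. case_ii s1 s2 d1 d2 p S A b T E))
     \<and>
     (\<forall>S \<in> min_decomps s1 s2 d1 d2 p. \<forall>A \<in> min_decomps s1 s2 d1 d2 p. S \<noteq> A \<longrightarrow>
      (\<forall>S' \<in> min_decomps s1 s2 d1 d2 p. \<forall>A' \<in> min_decomps s1 s2 d1 d2 p. S' \<noteq> A' \<longrightarrow>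
        ((\<exists>b T E. case_i s1 s2 d1 d2 p S A b T E) \<longleftrightarrow> (\<exists>b T E. case_i s1 s2 d1 d2 p S' A' b T E)) \<and>
        ((\<exists>b T E. case_ii s1 s2 d1 d2 p S A b T E) \<longleftrightarrow> (\<exists>b T E. case_ii s1 s2 d1 d2 p S' A' b T E)) \<and>
        (\<forall>b T E b' T' E'.
          (case_i s1 s2 d1 d2 p S A b T E \<and> case_i s1 s2 d1 d2 p S' A' b' T' E') \<or>
          (case_ii s1 s2 d1 d2 p S A b T E \<and> case_ii s1 s2 d1 d2 p S' A' b' T' E') \<longrightarrow> b = b')))
     \<and>
     (\<forall>p' \<in> sym_tensor_space s1 s2 d1 d2. p' \<noteq> 0 \<and> proj_pt tensor_scale p' = proj_pt tensor_scale p \<longrightarrow>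
      (\<forall>S \<in> min_decomps s1 s2 d1 d2 p. \<forall>A \<in> min_decomps s1 s2 d1 d2 p. S \<noteq> A \<longrightarrow>
       (\<forall>S' \<in> min_decomps s1 s2 d1 d2 p'. \<forall>A' \<in> min_decomps s1 s2 d1 d2 p'. S' \<noteq> A' \<longrightarrow>
        (\<forall>b T E b' T' E'.
          (case_i s1 s2 d1 d2 p S A b T E \<and> case_i s1 s2 d1 d2 p' S' A' b' T' E') \<or>
          (case_ii s1 s2 d1 d2 p S A b T E \<and> case_ii s1 s2 d1 d2 p' S' A' b' T' E') \<longrightarrow>
          T = T' \<and> E = E' \<and> E = S - (S \<inter> T) \<and> E = A - (A \<inter> T)))))"
proof -
  let ?D = "min_decomps s1 s2 d1 d2 p"
  \<comment> \<open>Cases (i) and (ii) reduced to the line, since \<open>S\<close> and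
    \<open>T\<close> determine \<open>E\<close> and \<open>b\<close>.\<close>
  define \<beta> where "\<beta> T S A \<longleftrightarrow> beta_line s1 s2 T \<and> splits_along d2 T S A" for T S A
  define \<alpha> where "\<alpha> T S A \<longleftrightarrow> alpha_line s1 s2 T \<and> splits_along d1 T S A" for T S A
  have small: "small_decomp d1 d2 S" if "S \<in> ?D" for S by (rule small_decompI[OF that ab not_one_factor])
  note fin = min_decompsD(1)[of _ s1 s2 d1 d2 p]
  have ex: "\<exists>T. \<beta> T S A \<or> \<alpha> T S A" if "S \<in> ?D" "A \<in> ?D" "S \<noteq> A" for S A
    using line_exists[OF V1(1) V2(1) p(2) _ _ that small[OF that(1)]] d unfolding \<alpha>_def \<beta>_def by simp
  have uniq_\<beta>: "T = T'" if "S \<in> ?D" "\<beta> T S A" "\<beta> T' S A'" for S A A' T T'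
    using beta_line_unique[OF V2(1) fin[OF that(1)] small[OF that(1)]] that(2,3)
    unfolding \<beta>_def splits_along_def by blast
  have uniq_\<alpha>: "T = T'" if "S \<in> ?D" "\<alpha> T S A" "\<alpha> T' S A'" for S A A' T T'
    using alpha_line_unique[OF V1(1) fin[OF that(1)] small[OF that(1)]] that(2,3)
    unfolding \<alpha>_def splits_along_def by blast
  have not_both: False if "S \<in> ?D" "\<alpha> T S A" "\<beta> T' S A'" for S A A' T T'
    using not_alpha_and_beta_line[OF fin[OF that(1)] small[OF that(1)]] that(2,3)
    unfolding \<alpha>_def \<beta>_def splits_along_def by blast
  have sym: "splits_along e T A S" if "S \<in> ?D" "A \<in> ?D" "splits_along e T S A" for S A T e
    using splits_along_sym[OF fin[OF that(1)] fin[OF that(2)] _ that(3)] min_decompsD(3)[OF that(1)]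
      min_decompsD(3)[OF that(2)] by simp
  have move_\<beta>: "\<beta> T S' A'" if "S \<in> ?D" "A \<in> ?D" "S' \<in> ?D" "A' \<in> ?D" "S' \<noteq> A'" "\<beta> T S A" for S A S' A' T
  proof -
    \<comment> \<open>Only the second member of the pair changes: \<open>S\<close> and
      \<open>B\<close> have a line of some kind, and comparison at the common member
      \<open>S\<close> shows that it is again \<open>T\<close>.\<close>
    have 1: "\<beta> T S B" if "B \<in> ?D" "S \<noteq> B" "S \<in> ?D" "\<beta> T S A" for S A B
      using ex[of S B] uniq_\<beta> not_both that by metis
    show ?thesis
    proof (cases "S = S'")
      case True
      then show ?thesis using 1 that by blast
    next
      case False
      then have "\<beta> T S S'" using 1 that by blast
      then have "\<beta> T S' S" using sym that unfolding \<beta>_def by blast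
      then show ?thesis using 1 that by blast
    qed
  qed
  have move_\<alpha>: "\<alpha> T S' A'" if "S \<in> ?D" "A \<in> ?D" "S' \<in> ?D" "A' \<in> ?D" "S' \<noteq> A'" "\<alpha> T S A" for S A S' A' T
  proof -
    have 1: "\<alpha> T S B" if "B \<in> ?D" "S \<noteq> B" "S \<in> ?D" "\<alpha> T S A" for S A B
      using ex[of S B] uniq_\<alpha> not_both that by metis
    show ?thesis
    proof (cases "S = S'")
      case True
      then show ?thesis using 1 that by blast
    next
      case False
      then have "\<alpha> T S S'" using 1 that by blast
      then have "\<alpha> T S' S" using sym that unfolding \<alpha>_def by blast
      then show ?thesis using 1 that by blast
    qed
  qed
  \<comment> \<open>For a line \<open>T\<close> shared by all pairs, this makes \<open>E\<close> and
    \<open>b\<close>, which are computed from the first member, agree for \<open>S\<close> and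
    \<open>S'\<close>. The degree \<open>e\<close> is \<open>d2\<close> for \<beta>-lines and
    \<open>d1\<close> for \<alpha>-lines.\<close>
  have diff: "S - T = S' - T \<and> card (S \<inter> T) = card (S' \<inter> T)"
    if "S \<in> ?D" "S' \<in> ?D" "\<And>B. B \<in> ?D \<Longrightarrow> S \<noteq> B \<Longrightarrow> splits_along e T S B" for S S' T e
  proof (cases "S = S'")
    case False
    then have "S - T = S' - T" using that unfolding splits_along_def by blast
    then show ?thesis
      using card_Int_eq_of_Diff_eq[OF fin[OF that(1)] fin[OF that(2)]] min_decompsD(3)[OF that(1)]
        min_decompsD(3)[OF that(2)] by simp
  qed simp
  have case_i: "case_i s1 s2 d1 d2 p S A b T E \<longleftrightarrow>
      \<beta> T S A \<and> E = S - T \<and> b = int d2 + 2 - int (card (S \<inter> T))" if "S \<in> ?D" "A \<in> ?D" for S A b T E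
    unfolding case_i_iff[OF that] \<beta>_def by blast
  have case_ii: "case_ii s1 s2 d1 d2 p S A b T E \<longleftrightarrow>
      \<alpha> T S A \<and> E = S - T \<and> b = int d1 + 2 - int (card (S \<inter> T))" if "S \<in> ?D" "A \<in> ?D" for S A b T E
    unfolding case_ii_iff[OF that] \<alpha>_def by blast
  have ex_i: "(\<exists>b T E. case_i s1 s2 d1 d2 p S A b T E) \<longleftrightarrow> (\<exists>T. \<beta> T S A)"
    and ex_ii: "(\<exists>b T E. case_ii s1 s2 d1 d2 p S A b T E) \<longleftrightarrow> (\<exists>T. \<alpha> T S A)"
    if "S \<in> ?D" "A \<in> ?D" for S A
    using case_i[OF that] case_ii[OF that] by blast+
  have same: "b = b' \<and> T = T' \<and> E = E' \<and> E = S - (S \<inter> T) \<and> E = A - (A \<inter> T)"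
    if D: "S \<in> ?D" "A \<in> ?D" "S' \<in> ?D" "A' \<in> ?D" "S \<noteq> A" "S' \<noteq> A'"
      and cases: "(case_i s1 s2 d1 d2 p S A b T E \<and> case_i s1 s2 d1 d2 p S' A' b' T' E') \<or>
        (case_ii s1 s2 d1 d2 p S A b T E \<and> case_ii s1 s2 d1 d2 p S' A' b' T' E')"
    for S A S' A' b b' T T' E E'
    using cases
  proof
    assume *: "case_i s1 s2 d1 d2 p S A b T E \<and> case_i s1 s2 d1 d2 p S' A' b' T' E'"
    then have \<beta>: "\<beta> T S A" "\<beta> T' S' A'" using case_i D by blast+
    have "T' = T" using uniq_\<beta>[OF D(3) \<beta>(2)] move_\<beta>[OF D(1-4,6) \<beta>(1)] by blast
    moreover have "S - T = S' - T \<and> card (S \<inter> T) = card (S' \<inter> T)"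
      using D(1,3) by (rule diff[where e = d2]) (use move_\<beta>[OF D(1,2,1) _ _ \<beta>(1)] in \<open>simp add: \<beta>_def\<close>)
    moreover have "S - T = A - T" using \<beta>(1) unfolding \<beta>_def splits_along_def by blast
    ultimately show ?thesis using * case_i D by (simp add: Diff_Int)
  next
    assume *: "case_ii s1 s2 d1 d2 p S A b T E \<and> case_ii s1 s2 d1 d2 p S' A' b' T' E'"
    then have \<alpha>: "\<alpha> T S A" "\<alpha> T' S' A'" using case_ii D by blast+
    have "T' = T" using uniq_\<alpha>[OF D(3) \<alpha>(2)] move_\<alpha>[OF D(1-4,6) \<alpha>(1)] by blast
    moreover have "S - T = S' - T \<and> card (S \<inter> T) = card (S' \<inter> T)"
      using D(1,3) by (rule diff[where e = d1]) (use move_\<alpha>[OF D(1,2,1) _ _ \<alpha>(1)] in \<open>simp add: \<alpha>_def\<close>)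
    moreover have "S - T = A - T" using \<alpha>(1) unfolding \<alpha>_def splits_along_def by blast
    ultimately show ?thesis using * case_ii D by (simp add: Diff_Int)
  qed
  have part1: "(\<exists>b T E. case_i s1 s2 d1 d2 p S A b T E) \<noteq> (\<exists>b T E. case_ii s1 s2 d1 d2 p S A b T E)"
    if "S \<in> ?D" "A \<in> ?D" "S \<noteq> A" for S A
    unfolding ex_i[OF that(1,2)] ex_ii[OF that(1,2)] using ex[OF that] not_both[OF that(1)] by blast
  have part2: "((\<exists>b T E. case_i s1 s2 d1 d2 p S A b T E) \<longleftrightarrow> (\<exists>b T E. case_i s1 s2 d1 d2 p S' A' b T E)) \<and>
      ((\<exists>b T E. case_ii s1 s2 d1 d2 p S A b T E) \<longleftrightarrow> (\<exists>b T E. case_ii s1 s2 d1 d2 p S' A' b T E))"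
    if D: "S \<in> ?D" "A \<in> ?D" "S \<noteq> A" "S' \<in> ?D" "A' \<in> ?D" "S' \<noteq> A'" for S A S' A'
    unfolding ex_i[OF D(1,2)] ex_ii[OF D(1,2)] ex_i[OF D(4,5)] ex_ii[OF D(4,5)]
    using move_\<beta>[OF D(1,2,4,5,6)] move_\<beta>[OF D(4,5,1,2,3)] move_\<alpha>[OF D(1,2,4,5,6)] move_\<alpha>[OF D(4,5,1,2,3)]
    by blast
  have part3: "T = T' \<and> E = E' \<and> E = S - (S \<inter> T) \<and> E = A - (A \<inter> T)"
    if pt: "proj_pt tensor_scale p' = proj_pt tensor_scale p" and D: "S \<in> ?D" "A \<in> ?D" "S \<noteq> A"
      and D': "S' \<in> min_decomps s1 s2 d1 d2 p'" "A' \<in> min_decomps s1 s2 d1 d2 p'" "S' \<noteq> A'"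
      and cases: "(case_i s1 s2 d1 d2 p S A b T E \<and> case_i s1 s2 d1 d2 p' S' A' b' T' E') \<or>
        (case_ii s1 s2 d1 d2 p S A b T E \<and> case_ii s1 s2 d1 d2 p' S' A' b' T' E')"
    for p' S A S' A' b b' T T' E E'
  proof -
    have D'': "S' \<in> ?D" "A' \<in> ?D" using D'(1,2) unfolding min_decomps_proj_pt[OF pt] .
    \<comment> \<open>For given minimal decompositions, the characterizations of the two cases do
      not mention the tensor, so a case for \<open>p'\<close> is the same case for
      \<open>p\<close>.\<close>
    have "(case_i s1 s2 d1 d2 p S A b T E \<and> case_i s1 s2 d1 d2 p S' A' b' T' E') \<or>
        (case_ii s1 s2 d1 d2 p S A b T E \<and> case_ii s1 s2 d1 d2 p S' A' b' T' E')"
      using cases unfolding case_i_iff[OF D'(1,2)] case_ii_iff[OF D'(1,2)] case_i_iff[OF D''] case_ii_iff[OF D''] .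
    then show ?thesis using same[OF D(1,2) D'' D(3) D'(3)] by blast
  qed
  show ?thesis
  proof (intro conjI ballI impI allI, goal_cases)
    case 1
    then show ?case by (rule part1)
  next
    case 2
    then show ?case by (rule part2[THEN conjunct1])
  next
    case 3
    then show ?case by (rule part2[THEN conjunct2])
  next
    case prems: 4
    show ?case using same[OF prems(1,2,4,5,3,6,7)] by (rule conjunct1)
  next
    case prems: 5
    show ?case using part3[OF conjunct2[OF prems(2)] prems(3-9)] by (elim conjE)
  next
    case prems: 6
    show ?case using part3[OF conjunct2[OF prems(2)] prems(3-9)] by (elim conjE)
  next
    case prems: 7
    show ?case using part3[OF conjunct2[OF prems(2)] prems(3-9)] by (elim conjE)
  next
    case prems: 8
    show ?case using part3[OF conjunct2[OF prems(2)] prems(3-9)] by (elim conjE)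
  qed
qed

end
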